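(* Let $(n^0,u^0,p^0)$ be initial data with $n^0\in L^1(\mathbb R)$, $u^0,p^0\in L^\infty(\mathbb R)\cap BV(\mathbb R)$, satisfying (a.e.) $0\le u^0$, $0\le p^0$, $0\le n^0\le n^*(x)$ and $(n^*(x)-n^0)p^0=0$. Then there exists $(n,u,p)$ with $$n\in L^\infty(]0,+\infty[_t,\,L^\infty(\mathbb R_x)\cap L^1(\mathbb R_x)),\qquad u,p\in L^\infty(]0,+\infty[_t,\,L^\infty(\mathbb R_x)),$$ which is a (weak) solution, with initial data $(n^0,u^0,p^0)$, of the system $$\partial_t n+\partial_x(nu)=0,\qquad \partial_t\big(n(u+p)I_\alpha\big)+\partial_x\big(nu(u+p)I_\alpha\big)=0,$$ $$0\le n\le n^*(x),\quad u\ge 0,\quad p\ge 0,\quad (n^*(x)-n)p=0.$$ Moreover this solution satisfies, for a.e. $(t,x)$, $$0\le u(t,x)\le 2\alpha\Big(\operatorname*{ess\,sup}_y u^0(y)+\operatorname*{ess\,sup}_y p^0(y)\Big),\qquad 0\le p(t,x)\le 2\alpha\Big(\operatorname*{ess\,sup}_y u^0(y)+\operatorname*{ess\,sup}_y p^0(y)\Big).$$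
   Context: Fix real numbers $r_1<\dots<r_M$ ($M$ finite), $r_0=-\infty$, $r_{M+1}=+\infty$, values $n_j^*\in\{1,2\}$ for $0\le j\le M$, and set $n^*(x)=\sum_{j=0}^M n_j^*\mathbf 1_{]r_j,r_{j+1}[}(x)$. Fix $\alpha\ge 1$ and set $I_\alpha(x)=1$ if $n^*(x)=1$ and $I_\alpha(x)=1/\alpha$ if $n^*(x)=2$. The pointwise constraints are understood a.e. in $]0,+\infty[\times\mathbb R$. Weak solution with initial data $(n^0,u^0,p^0)$ means: for all $\varphi\in C_c^\infty([0,+\infty[_t\times\mathbb R_x)$, $$\int_0^\infty\!\!\int_{\mathbb R}(n\,\partial_t\varphi+nu\,\partial_x\varphi)\,dx\,dt+\int_{\mathbb R}n^0(x)\varphi(0,x)\,dx=0,$$ $$\int_0^\infty\!\!\int_{\mathbb R}\big(n(u+p)I_\alpha\,\partial_t\varphi+nu(u+p)I_\alpha\,\partial_x\varphi\big)\,dx\,dt+\int_{\mathbb R}n^0(x)(u^0(x)+p^0(x))I_\alpha(x)\varphi(0,x)\,dx=0.$$ *)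

theory Defs
  imports "HOL-Probability.Essential_Supremum"
begin

text \<open>Functions of time and space are functions on \<open>real \<times> real\<close>, with points written \<open>(t, x)\<close>.
  Elements of Lebesgue spaces are represented by Lebesgue measurable functions.\<close>

definition half_plane :: "(real \<times> real) set" where
  "half_plane = {0..} \<times> UNIV"

definition open_half_plane :: "(real \<times> real) set" where
  "open_half_plane = {0<..} \<times> UNIV"

subsection \<open>Function spaces\<close>

definition Linfty :: "'a measure \<Rightarrow> ('a \<Rightarrow> real) set" where
  "Linfty M = {f \<in> borel_measurable M. \<exists>C. AE x in M. \<bar>f x\<bar> \<le> C}"

definition L1 :: "'a measure \<Rightarrow> ('a \<Rightarrow> real) set" where
  "L1 M = {f. integrable M f}"

text \<open>Functions of bounded variation on the line: locally integrable functions whose distributional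
  derivative is a finite measure. Integrability on the whole line is not required, so that
  nonzero constants, for example, belong to the space.\<close>

definition BV :: "(real \<Rightarrow> real) set" where
  "BV = {f. (\<forall>a b. set_integrable lebesgue {a..b} f) \<and>
            (\<exists>C. \<forall>\<phi>. \<phi> C1_differentiable_on UNIV \<longrightarrow> compact (closure {x. \<phi> x \<noteq> 0}) \<longrightarrow>
                   (\<forall>x. \<bar>\<phi> x\<bar> \<le> 1) \<longrightarrow> (LINT x|lebesgue. f x * deriv \<phi> x) \<le> C)}"

text \<open>\<open>L\<^sup>\<infinity>(]0,\<infinity>[; L\<^sup>\<infinity>)\<close> and \<open>L\<^sup>\<infinity>(]0,\<infinity>[; L\<^sup>1)\<close>. As usual for conservation laws, measurability means
  joint measurability in \<open>(t, x)\<close>; strong measurability as a map from time into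
  \<open>L\<^sup>\<infinity>\<close> would already exclude a travelling step.\<close>

definition Linfty_Linfty :: "(real \<times> real \<Rightarrow> real) set" where
  "Linfty_Linfty = {f \<in> borel_measurable (lebesgue_on open_half_plane).
     \<exists>C. AE t in lebesgue_on {0<..}.
       (\<lambda>x. f (t, x)) \<in> borel_measurable lebesgue \<and> (AE x in lebesgue. \<bar>f (t, x)\<bar> \<le> C)}"

definition Linfty_L1 :: "(real \<times> real \<Rightarrow> real) set" where
  "Linfty_L1 = {f \<in> borel_measurable (lebesgue_on open_half_plane).
     \<exists>C. AE t in lebesgue_on {0<..}.
       (\<lambda>x. f (t, x)) \<in> L1 lebesgue \<and> (LINT x|lebesgue. \<bar>f (t, x)\<bar>) \<le> C}"

subsection \<open>Test functions\<close>

text \<open>\<open>C\<^sup>k\<close> on the closed half-plane; at \<open>t = 0\<close> the time derivative is one-sided. The functions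
  \<open>g\<close> and \<open>h\<close> are the partial derivatives in \<open>t\<close> and \<open>x\<close>.\<close>

primrec Ck_half_plane :: "nat \<Rightarrow> (real \<times> real \<Rightarrow> real) \<Rightarrow> bool" where
  "Ck_half_plane 0 \<phi> \<longleftrightarrow> continuous_on half_plane \<phi>"
| "Ck_half_plane (Suc k) \<phi> \<longleftrightarrow>
     (\<exists>g h. (\<forall>z\<in>half_plane.
               (\<phi> has_derivative (\<lambda>(s, y). s * g z + y * h z)) (at z within half_plane)) \<and>
            Ck_half_plane k g \<and> Ck_half_plane k h)"

definition test_functions :: "(real \<times> real \<Rightarrow> real) set" where
  "test_functions =
     {\<phi>. (\<forall>k. Ck_half_plane k \<phi>) \<and> compact (closure {z \<in> half_plane. \<phi> z \<noteq> 0})}"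

subsection \<open>The road\<close>

text \<open>The breakpoints are \<open>r 1, \<dots>, r M\<close>; other values of \<open>r\<close> are ignored. Likewise only
  \<open>c 0, \<dots>, c M\<close> matter.\<close>

definition breakpoint :: "nat \<Rightarrow> (nat \<Rightarrow> real) \<Rightarrow> nat \<Rightarrow> ereal" where
  "breakpoint M r j = (if j = 0 then -\<infinity> else if j = M + 1 then \<infinity> else ereal (r j))"

definition nstar :: "nat \<Rightarrow> (nat \<Rightarrow> real) \<Rightarrow> (nat \<Rightarrow> real) \<Rightarrow> real \<Rightarrow> real" where
  "nstar M r c x =
     (\<Sum>j=0..M. c j * indicator {breakpoint M r j <..< breakpoint M r (Suc j)} (ereal x))"

text \<open>At the breakpoints, where \<open>nstar\<close> vanishes, the value is immaterial and set to \<open>0\<close>.\<close>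

definition I_fun :: "real \<Rightarrow> nat \<Rightarrow> (nat \<Rightarrow> real) \<Rightarrow> (nat \<Rightarrow> real) \<Rightarrow> real \<Rightarrow> real" where
  "I_fun \<alpha> M r c x =
     (if nstar M r c x = 1 then 1 else if nstar M r c x = 2 then 1 / \<alpha> else 0)"

subsection \<open>Weak solutions\<close>

text \<open>Weak form of \<open>\<partial>\<^sub>t \<rho> + \<partial>\<^sub>x q = 0\<close> with initial value \<open>\<rho>0\<close>.\<close>

definition weak_conservation_law ::
    "(real \<times> real \<Rightarrow> real) \<Rightarrow> (real \<times> real \<Rightarrow> real) \<Rightarrow> (real \<Rightarrow> real) \<Rightarrow> bool" where
  "weak_conservation_law \<rho> q \<rho>0 \<longleftrightarrow>
     (\<forall>\<phi>\<in>test_functions.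
        (LINT t:{0<..}|lebesgue. LINT x|lebesgue.
            \<rho> (t, x) * deriv (\<lambda>s. \<phi> (s, x)) t + q (t, x) * deriv (\<lambda>y. \<phi> (t, y)) x)
        + (LINT x|lebesgue. \<rho>0 x * \<phi> (0, x)) = 0)"

definition weak_solution ::
    "(real \<Rightarrow> real) \<Rightarrow> (real \<Rightarrow> real) \<Rightarrow> (real \<Rightarrow> real) \<Rightarrow> (real \<Rightarrow> real) \<Rightarrow> (real \<Rightarrow> real) \<Rightarrow>
     (real \<times> real \<Rightarrow> real) \<Rightarrow> (real \<times> real \<Rightarrow> real) \<Rightarrow> (real \<times> real \<Rightarrow> real) \<Rightarrow> bool" where
  "weak_solution ns I n0 u0 p0 n u p \<longleftrightarrow>
     weak_conservation_law n (\<lambda>z. n z * u z) n0 \<and>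
     weak_conservation_law
       (\<lambda>(t, x). n (t, x) * (u (t, x) + p (t, x)) * I x)
       (\<lambda>(t, x). n (t, x) * u (t, x) * (u (t, x) + p (t, x)) * I x)
       (\<lambda>x. n0 x * (u0 x + p0 x) * I x) \<and>
     (AE (t, x) in lebesgue_on open_half_plane.
        0 \<le> n (t, x) \<and> n (t, x) \<le> ns x \<and> 0 \<le> u (t, x) \<and> 0 \<le> p (t, x) \<and>
        (ns x - n (t, x)) * p (t, x) = 0)"

end

theory Submission
  imports Defs "HOL-Probability.Helly_Selection"
begin

text \<open>
  Idea: since uniqueness is not required, the traffic is stopped at every breakpoint, so that each
  piece of road evolves separately with constant \<open>n\<^sup>*\<close>. After division by \<open>n\<^sup>*\<close> the relative
  density \<open>h0 = n0 / n\<^sup>*\<close> is at most 1 and the quantity \<open>v = u0 + p0\<close> is transported by the cars as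
  their desired velocity. The follow-the-leader dynamics, in which a car moves at its desired speed
  unless it touches the next one, then has an explicit solution of Hopf-Lax type: with \<open>G' = h0\<close>, the
  car starting at \<open>y\<close> is at time \<open>t\<close> at
  \<open>X t y = G y + inf {z - G z + v z * t | z \<ge> y}\<close>, and a red light at \<open>r\<close> is the condition
  \<open>v r = 0\<close>. The density \<open>h \<le> 1\<close> is the Radon-Nikodym derivative of the image of \<open>h0 dy dt\<close>
  under the flow. A car that is slower than its desired velocity belongs to a block on which
  \<open>X - G\<close> is constant, and there \<open>h = 1\<close>; so the pressure \<open>v - X\<^sub>t\<close> lives where \<open>n = n\<^sup>*\<close>.
  The weak equations follow from the fundamental theorem of calculus along the trajectories.
  Bounded variation enters only through a representative of \<open>u0 + p0\<close> that is right lower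
  semicontinuous almost everywhere.
\<close>

subsection \<open>Trajectories\<close>

text \<open>The formula for \<open>X\<close> comes from shrinking every car to a point: in the
  coordinate X - G, which counts only free road, non-overlap means monotonicity in the label, a free
  car moves as \<open>z - G z + v z * t\<close>, and the solution is the greatest nondecreasing
  function of the label below that free motion. Little regularity is available: X is only
  nondecreasing in y, may jump, and is concave in t. Hence velocities are left derivatives, labels
  are recovered by a generalised inverse off a massless set, and the density comes from a measure
  instead of a Jacobian. A red light is a massless fictitious car, so it changes v on a finite set
  only and leaves the initial data unaffected. Cars carrying mass never cross a breakpoint; the
  factors \<open>nstar\<close> and \<open>I_fun\<close> are therefore constant along their
  trajectories, and both conservation laws become instances of one transport statement. Velocity and
  pressure are both bounded by V = ess sup u0 + ess sup p0, from which the stated bound follows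
  because 2 \<alpha> \<ge> 1.\<close>

locale follow_the_leader =
  fixes h0 v :: "real \<Rightarrow> real" and V :: real
  assumes h0_meas [measurable]: "h0 \<in> borel_measurable borel"
    and h0_nonneg: "\<And>y. 0 \<le> h0 y"
    and h0_le_1: "\<And>y. h0 y \<le> 1"
    and h0_int: "integrable lborel h0"
    and v_meas [measurable]: "v \<in> borel_measurable borel"
    and v_nonneg: "\<And>y. 0 \<le> v y"
    and v_le: "\<And>y. v y \<le> V"
begin

definition G :: "real \<Rightarrow> real" where
  "G y = (LINT x:{..y}|lborel. h0 x)"

definition Y :: "real \<Rightarrow> real \<Rightarrow> real" where
  "Y t y = (INF z\<in>{y..}. z - G z + v z * t)"

definition X :: "real \<Rightarrow> real \<Rightarrow> real" where
  "X t y = G y + Y t y"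

lemma V_nonneg: "0 \<le> V"
  using v_nonneg v_le order_trans by blast

lemma h0_set_int: "S \<in> sets borel \<Longrightarrow> set_integrable lborel S h0"
  unfolding set_integrable_def
  by (rule integrable_mult_indicator[OF _ h0_int]) auto

lemma G_diff:
  assumes "a \<le> b"
  shows "G b - G a = (LINT x:{a<..b}|lborel. h0 x)"
proof -
  have "G b = (LINT x:{..a} \<union> {a<..b}|lborel. h0 x)"
    unfolding G_def using assms by (simp add: ivl_disj_un_one(3))
  also have "\<dots> = G a + (LINT x:{a<..b}|lborel. h0 x)"
    unfolding G_def by (rule set_integral_Un) (auto intro!: h0_set_int)
  finally show ?thesis by simp
qed

lemma G_mono: "a \<le> b \<Longrightarrow> G a \<le> G b"
  using G_diff[of a b] unfolding set_lebesgue_integral_def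
  by (smt (verit) integral_nonneg_AE AE_I2 h0_nonneg indicator_pos_le mult_nonneg_nonneg real_scaleR_def)

lemma G_lip:
  assumes "a \<le> b"
  shows "G b - G a \<le> b - a"
proof -
  have "(LINT x:{a<..b}|lborel. h0 x) \<le> (LINT x:{a<..b}|lborel. 1)"
    by (rule set_integral_mono) (use assms h0_set_int h0_le_1 in \<open>auto simp: set_integrable_def\<close>)
  also have "\<dots> = b - a" using assms by (simp add: set_lebesgue_integral_def)
  finally show ?thesis using G_diff[OF assms] by simp
qed

lemma G_meas [measurable]: "G \<in> borel_measurable borel"
  by (rule borel_measurable_mono) (auto simp: mono_def G_mono)

text \<open>The term \<open>\<bar>t\<bar>\<close> admits negative times, which occur when left
  difference quotients at small t reach back before 0.\<close>

lemma Y_lower_aux: "y \<le> z \<Longrightarrow> y - G y - V * \<bar>t\<bar> \<le> z - G z + v z * t"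
proof -
  assume "y \<le> z"
  have "\<bar>v z * t\<bar> \<le> V * \<bar>t\<bar>"
    by (simp add: abs_mult mult_right_mono v_nonneg v_le)
  then show ?thesis using G_lip[OF \<open>y \<le> z\<close>] by linarith
qed

lemma Y_bdd: "bdd_below ((\<lambda>z. z - G z + v z * t) ` {y..})"
  using Y_lower_aux by (auto intro!: bdd_belowI2)

lemma Y_le: "y \<le> z \<Longrightarrow> Y t y \<le> z - G z + v z * t"
  unfolding Y_def by (rule cINF_lower[OF Y_bdd]) auto

lemma Y_greatest: "(\<And>z. y \<le> z \<Longrightarrow> m \<le> z - G z + v z * t) \<Longrightarrow> m \<le> Y t y"
  unfolding Y_def by (rule cINF_greatest) auto

lemma Y_mono: "y \<le> y' \<Longrightarrow> Y t y \<le> Y t y'"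
  by (rule Y_greatest) (auto intro: Y_le)

lemma X_mono: "y \<le> y' \<Longrightarrow> X t y \<le> X t y'"
  unfolding X_def using Y_mono G_mono by (meson add_mono)

text \<open>Non-overlap: since \<open>Y t\<close> is nondecreasing, the labels between y and y'
  always occupy at least their own mass.\<close>

lemma X_diff: "y \<le> y' \<Longrightarrow> G y' - G y \<le> X t y' - X t y"
  unfolding X_def using Y_mono[of y y' t] by simp

lemma X_ge: "0 \<le> t \<Longrightarrow> y \<le> X t y"
proof -
  assume "0 \<le> t"
  have "y - G y \<le> Y t y"
    using G_lip[of y] mult_nonneg_nonneg[OF v_nonneg \<open>0 \<le> t\<close>] by (intro Y_greatest) (smt (verit))
  then show ?thesis by (simp add: X_def)
qed

lemma X_le: "X t y \<le> y + v y * t"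
  unfolding X_def using Y_le[of y y t] by simp

lemma X_0 [simp]: "X 0 y = y"
  using X_ge[of 0 y] X_le[of 0 y] by simp

lemma X_mono_t:
  assumes "s \<le> t" shows "X s y \<le> X t y"
proof -
  have "Y s y \<le> Y t y"
    by (rule Y_greatest) (smt (verit, best) Y_le assms mult_left_mono v_nonneg)
  then show ?thesis by (simp add: X_def)
qed

lemma X_lip_t:
  assumes "s \<le> t" shows "X t y \<le> X s y + V * (t - s)"
proof -
  have "Y t y - V * (t - s) \<le> Y s y"
  proof (rule Y_greatest)
    fix z assume "y \<le> z"
    have "v z * t \<le> v z * s + V * (t - s)"
      using mult_right_mono[OF v_le[of z], of "t - s"] assms by (simp add: algebra_simps)
    then show "Y t y - V * (t - s) \<le> z - G z + v z * s"
      using Y_le[OF \<open>y \<le> z\<close>, of t] by linarith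
  qed
  then show ?thesis by (simp add: X_def)
qed

lemma X_lip_t_abs: "\<bar>X t y - X s y\<bar> \<le> V * \<bar>t - s\<bar>"
  using X_mono_t[of s t y] X_mono_t[of t s y] X_lip_t[of s t y] X_lip_t[of t s y]
  by (cases "s \<le> t") auto

lemma X_bounds: "y - V * \<bar>t\<bar> \<le> X t y" "X t y \<le> y + V * \<bar>t\<bar>"
  using X_lip_t_abs[of t y 0] by auto

lemma X_cont_t: "continuous_on S (\<lambda>t. X t y)"
proof (rule continuous_on_subset[OF lipschitz_on_continuous_on])
  show "V-lipschitz_on UNIV (\<lambda>t. X t y)"
    by (rule lipschitz_onI) (auto simp: dist_real_def X_lip_t_abs V_nonneg)
qed simp

text \<open>An infimum of functions affine in t is concave in t; this is what makes left difference
  quotients monotone in the step.\<close>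

lemma X_concave:
  assumes "0 \<le> \<theta>" "\<theta> \<le> 1"
  shows "\<theta> * X s y + (1 - \<theta>) * X t y \<le> X (\<theta> * s + (1 - \<theta>) * t) y"
proof -
  have "\<theta> * Y s y + (1 - \<theta>) * Y t y \<le> Y (\<theta> * s + (1 - \<theta>) * t) y"
  proof (rule Y_greatest)
    fix z assume z: "y \<le> z"
    have "\<theta> * Y s y + (1 - \<theta>) * Y t y
        \<le> \<theta> * (z - G z + v z * s) + (1 - \<theta>) * (z - G z + v z * t)"
      using assms by (intro add_mono mult_left_mono Y_le z) auto
    also have "\<dots> = z - G z + v z * (\<theta> * s + (1 - \<theta>) * t)"
      by (simp add: algebra_simps)
    finally show "\<theta> * Y s y + (1 - \<theta>) * Y t y \<le> z - G z + v z * (\<theta> * s + (1 - \<theta>) * t)" .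
  qed
  then show ?thesis by (simp add: X_def algebra_simps)
qed

lemma X_quotient_mono:
  assumes "0 < h" "h \<le> k"
  shows "(X t y - X (t - h) y) / h \<le> (X t y - X (t - k) y) / k"
proof -
  have "(h / k) * X (t - k) y + (1 - h / k) * X t y \<le> X ((h / k) * (t - k) + (1 - h / k) * t) y"
    using assms by (intro X_concave) auto
  also have "(h / k) * (t - k) + (1 - h / k) * t = t - h"
    using assms by (simp add: field_simps)
  finally have "X t y - X (t - h) y \<le> (h / k) * (X t y - X (t - k) y)"
    by (simp add: algebra_simps)
  then show ?thesis using assms by (simp add: field_simps)
qed

lemma X_meas_y [measurable]: "X t \<in> borel_measurable borel"
  by (rule borel_measurable_mono) (auto simp: mono_def X_mono)

text \<open>X is nondecreasing and Lipschitz in t, so a strict inequality survives until some later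
  rational time. Sublevel sets thus become countable unions of rectangles, which gives joint
  measurability.\<close>

lemma X_less_iff: "X t y < a \<longleftrightarrow> (\<exists>q\<in>\<rat>. t < q \<and> X q y < a)"
proof
  assume a: "X t y < a"
  \<comment> \<open>During a time e the position grows by at most V e; dividing by V + 1 keeps the
    denominator positive and the final inequality strict.\<close>
  define e where "e = (a - X t y) / (V + 1)"
  have e: "0 < e" using a V_nonneg by (auto simp: e_def)
  obtain q where q: "q \<in> \<rat>" "t < q" "q < t + e"
    using Rats_dense_in_real[of t "t + e"] e by auto
  have "X q y \<le> X t y + V * (q - t)" using q by (intro X_lip_t) auto
  also have "\<dots> < X t y + (V + 1) * e"
    using q V_nonneg e by (smt (verit, ccfv_SIG) mult_left_mono mult_strict_right_mono)
  also have "\<dots> = a" using V_nonneg by (simp add: e_def)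
  finally show "\<exists>q\<in>\<rat>. t < q \<and> X q y < a" using q by auto
next
  assume "\<exists>q\<in>\<rat>. t < q \<and> X q y < a"
  then show "X t y < a" using X_mono_t by (smt (verit))
qed

lemma X_meas: "(\<lambda>(t, y). X t y) \<in> borel_measurable (borel \<Otimes>\<^sub>M borel)"
proof (rule borel_measurableI_less)
  fix a
  have "{z \<in> space (borel \<Otimes>\<^sub>M borel). (case z of (t, y) \<Rightarrow> X t y) < a}
      = (\<Union>q\<in>\<rat>. {..<q} \<times> {y \<in> space borel. X q y < a})"
  proof (rule set_eqI)
    fix w :: "real \<times> real"
    obtain t y where w: "w = (t, y)" by fastforce
    show "w \<in> {z \<in> space (borel \<Otimes>\<^sub>M borel). (case z of (t, y) \<Rightarrow> X t y) < a}
        \<longleftrightarrow> w \<in> (\<Union>q\<in>\<rat>. {..<q} \<times> {y \<in> space borel. X q y < a})"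
      unfolding w using X_less_iff[of t y a] by (auto simp only: space_pair_measure space_borel split: prod.split)
  qed
  also have "\<dots> \<in> sets (borel \<Otimes>\<^sub>M borel)"
    by (intro sets.countable_UN' countable_rat) auto
  finally show "{z \<in> space (borel \<Otimes>\<^sub>M borel). (case z of (t, y) \<Rightarrow> X t y) < a} \<in> sets (borel \<Otimes>\<^sub>M borel)" .
qed

lemma X_meas' [measurable (raw)]:
  assumes "f \<in> borel_measurable M" "g \<in> borel_measurable M"
  shows "(\<lambda>w. X (f w) (g w)) \<in> borel_measurable M"
  using measurable_compose[OF measurable_Pair[OF assms] X_meas] by simp

text \<open>The candidate \<open>z = r\<close> of the infimum does not move, so the cars behind r
  queue up before it, at a distance no smaller than the mass in between.\<close>

lemma X_barrier:
  assumes "v r = 0" "y \<le> r" shows "X t y \<le> r - (G r - G y)"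
  using Y_le[OF assms(2), of t] assms(1) by (simp add: X_def)

text \<open>Left derivative of X in t. By concavity the quotients decrease as the step shrinks, so
  it exists at every t; the steps 1 / (k + 1) make it a countable infimum and hence jointly
  measurable.\<close>

definition uL :: "real \<Rightarrow> real \<Rightarrow> real" where
  "uL t y = (INF k. (X t y - X (t - 1 / real (Suc k)) y) * real (Suc k))"

lemma uL_seq:
  shows uL_decseq: "decseq (\<lambda>k. (X t y - X (t - 1 / real (Suc k)) y) * real (Suc k))"
    and uL_bdd: "\<And>k. 0 \<le> (X t y - X (t - 1 / real (Suc k)) y) * real (Suc k)"
proof -
  show "0 \<le> (X t y - X (t - 1 / real (Suc k)) y) * real (Suc k)" for k
    using X_mono_t[of "t - 1 / real (Suc k)" t y] by (intro mult_nonneg_nonneg) auto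
  show "decseq (\<lambda>k. (X t y - X (t - 1 / real (Suc k)) y) * real (Suc k))"
  proof (rule decseq_SucI)
    fix k
    have "1 / real (Suc (Suc k)) \<le> 1 / real (Suc k)" by (simp add: frac_le)
    from X_quotient_mono[OF _ this, of t y]
    show "(X t y - X (t - 1 / real (Suc (Suc k))) y) * real (Suc (Suc k))
       \<le> (X t y - X (t - 1 / real (Suc k)) y) * real (Suc k)"
      by (simp del: of_nat_Suc)
  qed
qed

lemma uL_lim: "(\<lambda>k. (X t y - X (t - 1 / real (Suc k)) y) * real (Suc k)) \<longlonglongrightarrow> uL t y"
  unfolding uL_def
  by (intro LIMSEQ_decseq_INF bdd_belowI2[where m=0] uL_bdd uL_decseq)

lemma uL_nonneg: "0 \<le> uL t y"
  unfolding uL_def by (intro cINF_greatest uL_bdd) auto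

lemma uL_le: "uL t y \<le> (X t y - X (t - 1 / real (Suc k)) y) * real (Suc k)"
  unfolding uL_def by (intro cINF_lower bdd_belowI2[where m=0] uL_bdd) auto

text \<open>By concavity a short left quotient is at most the quotient over all of [0, t], which is
  the average velocity and does not exceed v y.\<close>

lemma uL_le_v:
  assumes "0 < t" shows "uL t y \<le> v y"
proof -
  obtain k where k: "1 / real (Suc k) < t" using reals_Archimedean[OF assms] by (auto simp: field_simps)
  have "uL t y \<le> (X t y - X (t - 1 / real (Suc k)) y) / (1 / real (Suc k))"
    using uL_le[of t y k] by simp
  also have "\<dots> \<le> (X t y - X (t - t) y) / t" using k by (intro X_quotient_mono) auto
  also have "\<dots> \<le> v y" using assms X_le[of t y] by (simp add: field_simps)
  finally show ?thesis .
qed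

lemma uL_le_V: "uL t y \<le> V"
  using uL_le[of t y 0] X_lip_t[of "t - 1" t y] by simp

text \<open>The line y + v y s lies above the trajectory for all s and meets it at s = t, so every
  left quotient at t is at least v y.\<close>

lemma uL_contact:
  assumes "X t y = y + v y * t" "0 < t" shows "uL t y = v y"
proof (rule antisym[OF uL_le_v[OF assms(2)]])
  show "v y \<le> uL t y"
    unfolding uL_def
  proof (rule cINF_greatest)
    fix k
    have "X (t - 1 / real (Suc k)) y \<le> y + v y * (t - 1 / real (Suc k))" by (rule X_le)
    then have "v y * (1 / real (Suc k)) \<le> X t y - X (t - 1 / real (Suc k)) y"
      by (simp add: assms(1) algebra_simps del: of_nat_Suc)
    then show "v y \<le> (X t y - X (t - 1 / real (Suc k)) y) * real (Suc k)"
      by (simp add: field_simps del: of_nat_Suc)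
  qed auto
qed

lemma uL_meas [measurable (raw)]:
  assumes [measurable]: "f \<in> borel_measurable M" "g \<in> borel_measurable M"
  shows "(\<lambda>w. uL (f w) (g w)) \<in> borel_measurable M"
  unfolding uL_def by measurable

text \<open>Right lower semicontinuity of \<open>v\<close>, except on a null set, is what makes the infimum defining
  \<open>Y\<close> local at points where it is attained to the right only in the limit.\<close>

definition right_lsc :: "real \<Rightarrow> bool" where
  "right_lsc y \<longleftrightarrow> (\<forall>e>0. \<exists>d>0. \<forall>z\<in>{y..<y+d}. v y - e < v z)"

text \<open>For a late car the candidate z = y does not realise the infimum, and by right lower
  semicontinuity neither do the candidates just ahead. The infimum is therefore the one over z \<ge>
  y + d, and \<open>Y t\<close> is constant up to there.\<close>

lemma blocked:
  assumes "right_lsc y" "0 < t" "X t y < y + v y * t"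
  obtains c where "y < c" "Y t c = Y t y"
proof -
  \<comment> \<open>Half of the delay is spent on the semicontinuity estimate; the other half keeps
    \<open>Y t y\<close> strictly below the nearby candidates.\<close>
  define e where "e = (y + v y * t - X t y) / 2"
  have e: "0 < e" using assms by (simp add: e_def)
  obtain d where d: "d > 0" "\<And>z. z \<in> {y..<y+d} \<Longrightarrow> v y - e / t < v z"
    using assms(1) e assms(2) unfolding right_lsc_def by (metis divide_pos_pos)
  have far: "Y t (y + d) \<le> z - G z + v z * t \<or> y - G y + v y * t - e \<le> z - G z + v z * t"
    if "y \<le> z" for z
  proof (cases "z < y + d")
    case True
    then have "(v y - e / t) * t \<le> v z * t"
      using that d(2)[of z] assms(2) by (intro mult_right_mono) auto
    then have "v y * t - e \<le> v z * t" using assms(2) by (simp add: algebra_simps)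
    then show ?thesis using G_lip[OF that] by linarith
  qed (auto intro: Y_le)
  have "min (Y t (y + d)) (y - G y + v y * t - e) \<le> Y t y"
    by (rule Y_greatest) (use far in \<open>simp add: min_le_iff_disj\<close>)
  moreover have "Y t y < y - G y + v y * t - e"
    using e assms(3) by (simp add: X_def e_def field_simps)
  ultimately have "Y t (y + d) \<le> Y t y" by linarith
  then show ?thesis using that[of "y + d"] Y_mono[of y "y + d" t] d(1) by auto
qed

end

subsection \<open>The inverse flow\<close>

text \<open>The function \<open>F\<close> is nondecreasing and continuous, hence the distribution
  function of a measure \<nu>. On half-open intervals \<mu> + \<nu> is Lebesgue measure, by a Dynkin
  argument also on Borel sets, and \<nu> \<ge> 0 gives the inequality.\<close>

lemma emeasure_le_lborel:
  fixes \<mu> :: "real measure"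
  assumes fin: "finite_measure \<mu>" and sets [measurable_cong]: "sets \<mu> = sets borel"
    and le: "\<And>a b. a \<le> b \<Longrightarrow> measure \<mu> {a<..b} \<le> b - a"
    and B: "B \<in> sets borel"
  shows "emeasure \<mu> B \<le> emeasure lborel B"
proof -
  interpret finite_measure \<mu> by (rule fin)
  define F where "F x = x - measure \<mu> {..x}" for x
  have Ioc: "measure \<mu> {a<..b} = measure \<mu> {..b} - measure \<mu> {..a}" if "a \<le> b" for a b
  proof -
    have "measure \<mu> ({..b} - {..a}) = measure \<mu> {..b} - measure \<mu> {..a}"
      using that by (intro finite_measure_Diff) auto
    moreover have "{..b} - {..a} = {a<..b}" by auto
    ultimately show ?thesis by simp
  qed
  have F_mono: "F a \<le> F b" if "a \<le> b" for a b
    using le[OF that] Ioc[OF that] by (simp add: F_def)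
  have F_lip: "F b - F a \<le> b - a" if "a \<le> b" for a b
    using Ioc[OF that] measure_nonneg[of \<mu> "{a<..b}"] by (simp add: F_def)
  have "1-lipschitz_on UNIV F"
  proof (rule lipschitz_onI)
    fix a b show "dist (F a) (F b) \<le> 1 * dist a b"
      using F_lip[of a b] F_lip[of b a] F_mono[of a b] F_mono[of b a]
      by (cases "a \<le> b") (auto simp: dist_real_def)
  qed simp
  then have F_cont: "continuous (at_right a) F" for a
    using lipschitz_on_continuous_on continuous_on_imp_continuous_within by blast
  define \<nu> where "\<nu> = interval_measure F"
  have [measurable_cong]: "sets \<nu> = sets borel" by (simp add: \<nu>_def)
  have \<nu>_Ioc: "emeasure \<nu> {a<..b} = ennreal (F b - F a)" if "a \<le> b" for a b
    unfolding \<nu>_def using that F_mono F_cont by (rule emeasure_interval_measure_Ioc)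
  \<comment> \<open>Bounded windows make all three measures finite, so that complements can be
    subtracted in the Dynkin induction.\<close>
  define J where "J n = {- real n<..real n}" for n
  have sum: "emeasure \<mu> (S \<inter> J n) + emeasure \<nu> (S \<inter> J n) = emeasure lborel (S \<inter> J n)"
    if "S \<in> sets borel" for S n
  proof -
    have window: "emeasure \<mu> {a<..b} + emeasure \<nu> {a<..b} = emeasure lborel {a<..b}" for a b
    proof (cases "a \<le> b")
      case True
      then have "F b - F a = b - a - measure \<mu> {a<..b}" by (simp add: F_def Ioc)
      then have "emeasure \<nu> {a<..b} = ennreal (b - a - measure \<mu> {a<..b})"
        using \<nu>_Ioc[OF True] by simp
      moreover have "emeasure lborel {a<..b} = ennreal (b - a)" using True by simp
      ultimately show ?thesis
        using le[OF True] by (simp add: emeasure_eq_measure flip: ennreal_plus)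
    qed auto
    have "Int_stable (range (\<lambda>(a, b). {a<..b::real}))"
      by (auto simp: Int_stable_def)
    moreover have "range (\<lambda>(a, b). {a<..b::real}) \<subseteq> Pow UNIV" by simp
    moreover have "S \<in> sigma_sets UNIV (range (\<lambda>(a, b). {a<..b}))"
      using that by (simp add: borel_sigma_sets_Ioc)
    ultimately show ?thesis
    proof (induction rule: sigma_sets_induct_disjoint[consumes 3, case_names basic empty compl union])
      case (basic S)
      then obtain a b where "S = {a<..b}" by auto
      then have "S \<inter> J n = {max a (- real n)<..min b (real n)}" by (auto simp: J_def)
      then show ?case using window by simp
    next
      case (compl S)
      then have [measurable]: "S \<in> sets borel" by (simp add: borel_sigma_sets_Ioc)
      have [measurable]: "J n \<in> sets borel" by (simp add: J_def)
      have split: "emeasure N (J n) = emeasure N (S \<inter> J n) + emeasure N ((UNIV - S) \<inter> J n)"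
        if [measurable_cong]: "sets N = sets borel" for N :: "real measure"
        by (subst plus_emeasure) (auto intro: arg_cong[where f="emeasure N"])
      have "emeasure lborel (S \<inter> J n) + (emeasure \<mu> ((UNIV - S) \<inter> J n) + emeasure \<nu> ((UNIV - S) \<inter> J n))
          = emeasure \<mu> (J n) + emeasure \<nu> (J n)"
        unfolding compl.IH[symmetric] split[OF sets] split[OF \<open>sets \<nu> = sets borel\<close>]
        by (simp add: ac_simps)
      also have "\<dots> = emeasure lborel (S \<inter> J n) + emeasure lborel ((UNIV - S) \<inter> J n)"
        using window[of "- real n" "real n"] by (simp flip: split[OF sets_lborel] J_def)
      finally show ?case
        using emeasure_mono[of "S \<inter> J n" "J n" lborel]
        by (auto simp: ennreal_add_left_cancel J_def top_unique)
    next
      case (union A)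
      then have [measurable]: "\<And>i. A i \<in> sets borel" by (auto simp: borel_sigma_sets_Ioc)
      have *: "\<Union>(range A) \<inter> J n = (\<Union>i. A i \<inter> J n)" by auto
      have [measurable]: "J n \<in> sets borel" by (simp add: J_def)
      have d: "disjoint_family (\<lambda>i. A i \<inter> J n)"
        using union(1) by (auto simp: disjoint_family_on_def)
      show ?case unfolding *
        using union.IH
        by (subst (1 2 3) suminf_emeasure[symmetric]) (auto simp: d suminf_add[OF summableI summableI])
    qed auto
  qed
  have [measurable]: "J n \<in> sets borel" for n by (simp add: J_def)
  have "emeasure \<mu> (B \<inter> J n) \<le> emeasure lborel B" for n
  proof -
    have "emeasure \<mu> (B \<inter> J n) \<le> emeasure lborel (B \<inter> J n)"
      unfolding sum[OF B, symmetric] by simp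
    also have "\<dots> \<le> emeasure lborel B" using B by (intro emeasure_mono) auto
    finally show ?thesis .
  qed
  moreover have "(SUP n. emeasure \<mu> (B \<inter> J n)) = emeasure \<mu> (\<Union>n. B \<inter> J n)"
    using B by (intro SUP_emeasure_incseq) (auto simp: incseq_def J_def)
  moreover have "(\<Union>n. B \<inter> J n) = B"
  proof -
    have "\<exists>n. x \<in> J n" for x
    proof -
      obtain n where "\<bar>x\<bar> < real n" using reals_Archimedean2 by blast
      then have "x \<in> J n" by (simp add: J_def abs_less_iff)
      then show ?thesis ..
    qed
    then show ?thesis by auto
  qed
  ultimately show ?thesis by (metis (no_types, lifting) SUP_least)
qed

context follow_the_leader
begin

text \<open>Generalised inverse of the nondecreasing map \<open>X t\<close>. As \<open>X t\<close>
  may jump, the supremum need not be attained, so it is strict comparisons of labels with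
  \<open>A t x\<close> that transfer to positions.\<close>

definition A :: "real \<Rightarrow> real \<Rightarrow> real" where
  "A t x = Sup {y. X t y \<le> x}"

lemma A_ne: "{y. X t y \<le> x} \<noteq> {}" and A_bdd: "bdd_above {y. X t y \<le> x}"
proof -
  show "{y. X t y \<le> x} \<noteq> {}"
    using X_bounds(2)[of t "x - V * \<bar>t\<bar>"] by auto
  show "bdd_above {y. X t y \<le> x}"
    using X_bounds(1)[of _ t] by (intro bdd_aboveI[of _ "x + V * \<bar>t\<bar>"]) (smt (verit, best) mem_Collect_eq)
qed

lemma le_A: "X t y \<le> x \<Longrightarrow> y \<le> A t x"
  unfolding A_def by (rule cSup_upper[OF _ A_bdd]) simp

lemma less_A_iff: "a < A t x \<longleftrightarrow> (\<exists>y>a. X t y \<le> x)"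
  unfolding A_def less_cSup_iff[OF A_ne A_bdd] by auto

lemma X_le_of_less_A: "y < A t x \<Longrightarrow> X t y \<le> x"
  unfolding less_A_iff using X_mono[of y _ t] by (metis less_imp_le order_trans)

lemma less_X_of_A_less: "A t x < y \<Longrightarrow> x < X t y"
  using le_A[of t y x] by linarith

lemma A_mono: "x \<le> x' \<Longrightarrow> A t x \<le> A t x'"
  unfolding A_def by (rule cSup_subset_mono[OF A_ne A_bdd]) auto

lemma less_A_iff_rat: "a < A t x \<longleftrightarrow> (\<exists>q\<in>\<rat>. a < q \<and> X t q \<le> x)"
  using Rats_dense_in_real[of a] X_le_of_less_A less_A_iff by (metis (no_types, lifting))

lemma A_meas: "(\<lambda>(t, x). A t x) \<in> borel_measurable (borel \<Otimes>\<^sub>M borel)"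
proof (rule borel_measurableI_greater)
  fix a
  have "{z \<in> space (borel \<Otimes>\<^sub>M borel). a < (case z of (t, x) \<Rightarrow> A t x)}
      = (\<Union>q\<in>{q\<in>\<rat>. a < q}. {z \<in> space (borel \<Otimes>\<^sub>M borel). X (fst z) q \<le> snd z})"
  proof (rule set_eqI)
    fix w :: "real \<times> real"
    obtain t x where w: "w = (t, x)" by fastforce
    show "w \<in> {z \<in> space (borel \<Otimes>\<^sub>M borel). a < (case z of (t, x) \<Rightarrow> A t x)}
        \<longleftrightarrow> w \<in> (\<Union>q\<in>{q\<in>\<rat>. a < q}. {z \<in> space (borel \<Otimes>\<^sub>M borel). X (fst z) q \<le> snd z})"
      unfolding w using less_A_iff_rat[of a t x]
      by (auto simp only: space_pair_measure space_borel fst_conv snd_conv split: prod.split)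
  qed
  also have "\<dots> \<in> sets (borel \<Otimes>\<^sub>M borel)"
  proof (intro sets.countable_UN')
    show "countable {q \<in> \<rat>. a < q}" using countable_rat by (rule countable_subset[rotated]) auto
  qed auto
  finally show "{z \<in> space (borel \<Otimes>\<^sub>M borel). a < (case z of (t, x) \<Rightarrow> A t x)} \<in> sets (borel \<Otimes>\<^sub>M borel)" .
qed

lemma A_meas' [measurable (raw)]:
  assumes "f \<in> borel_measurable M" "g \<in> borel_measurable M"
  shows "(\<lambda>w. A (f w) (g w)) \<in> borel_measurable M"
  using measurable_compose[OF measurable_Pair[OF assms] A_meas] by simp

text \<open>Labels strictly between \<open>A t a\<close> and \<open>A t b\<close> sit in [a, b], and
  by non-overlap they occupy at least their mass.\<close>

lemma G_A_lip:
  assumes "a \<le> b" shows "G (A t b) - G (A t a) \<le> b - a"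
proof (rule ccontr)
  assume c: "\<not> ?thesis"
  then have "A t a < A t b"
    using A_mono[OF assms, of t] assms by (cases "A t a = A t b") auto
  \<comment> \<open>Since the suprema need not be attained, both labels move inwards by d. This
    costs at most 2 d of mass, while the assumed excess is at least 4 d; the first term of the
    minimum keeps the labels in order.\<close>
  define d where "d = min ((A t b - A t a) / 4) ((G (A t b) - G (A t a) - (b - a)) / 4)"
  have d: "0 < d" "d \<le> (A t b - A t a) / 4" "d \<le> (G (A t b) - G (A t a) - (b - a)) / 4"
    unfolding d_def using c \<open>A t a < A t b\<close> by (simp, intro min.cobounded1, intro min.cobounded2)
  have "X t (A t b - d) \<le> b" using d by (intro X_le_of_less_A) auto
  moreover have "a < X t (A t a + d)" using d by (intro less_X_of_A_less) auto
  moreover have "G (A t b - d) - G (A t a + d) \<le> X t (A t b - d) - X t (A t a + d)"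
    using d by (intro X_diff) auto
  moreover have "G (A t a + d) - G (A t a) \<le> d" "G (A t b) - G (A t b - d) \<le> d"
    using G_lip[of "A t a" "A t a + d"] G_lip[of "A t b - d" "A t b"] d by auto
  moreover have "4 * d \<le> G (A t b) - G (A t a) - (b - a)" using d(3) by simp
  ultimately show False using d(1) by argo
qed

section \<open>Transport of the mass at a fixed time\<close>

definition \<rho> :: "real measure" where
  "\<rho> = density lborel (\<lambda>y. ennreal (h0 y))"

lemma sets_\<rho> [measurable_cong]: "sets \<rho> = sets borel" and space_\<rho> [simp]: "space \<rho> = UNIV"
  by (simp_all add: \<rho>_def)

lemma emeasure_\<rho>: "S \<in> sets borel \<Longrightarrow> emeasure \<rho> S = ennreal (LINT y:S|lborel. h0 y)"
proof -
  assume S: "S \<in> sets borel"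
  have "emeasure \<rho> S = (\<integral>\<^sup>+ y. ennreal (indicator S y *\<^sub>R h0 y) \<partial>lborel)"
    using S unfolding \<rho>_def
    by (subst emeasure_density) (auto intro!: nn_integral_cong split: split_indicator)
  also have "\<dots> = ennreal (LINT y:S|lborel. h0 y)"
    unfolding set_lebesgue_integral_def
    using h0_set_int[OF S] h0_nonneg by (intro nn_integral_eq_integral) (auto simp: set_integrable_def)
  finally show ?thesis .
qed

sublocale \<rho>: finite_measure \<rho>
  by (rule finite_measureI) (simp add: emeasure_\<rho>)

lemma null_\<rho>: "N \<in> null_sets lborel \<Longrightarrow> N \<in> null_sets \<rho>"
proof -
  assume N: "N \<in> null_sets lborel"
  have "absolutely_continuous lborel \<rho>"
    unfolding \<rho>_def by (rule absolutely_continuousI_density) measurable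
  then show "N \<in> null_sets \<rho>"
    using N unfolding absolutely_continuous_def by blast
qed

lemma measure_\<rho>_X: "measure \<rho> {y. X t y \<le> x} = G (A t x)"
proof -
  have "measure \<rho> {y. X t y \<le> x} = measure \<rho> {..A t x}"
  proof (rule measure_eq_AE)
    have "{A t x} \<in> null_sets \<rho>" by (rule null_\<rho>) (auto simp: null_sets_def)
    then have "AE y in \<rho>. y \<notin> {A t x}" by (rule AE_not_in)
    then show "AE y in \<rho>. y \<in> {y. X t y \<le> x} \<longleftrightarrow> y \<in> {..A t x}"
      by eventually_elim (use le_A X_le_of_less_A in force)
  qed (auto simp: sets_\<rho>)
  also have "\<dots> = G (A t x)"
    unfolding measure_def G_def
    by (simp add: emeasure_\<rho> set_lebesgue_integral_def h0_nonneg)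
  finally show ?thesis .
qed

definition \<mu>1 :: "real \<Rightarrow> real measure" where
  "\<mu>1 t = distr \<rho> borel (X t)"

lemma sets_\<mu>1 [measurable_cong]: "sets (\<mu>1 t) = sets borel" and space_\<mu>1 [simp]: "space (\<mu>1 t) = UNIV"
  by (simp_all add: \<mu>1_def)

lemma finite_\<mu>1: "finite_measure (\<mu>1 t)"
  unfolding \<mu>1_def by (rule \<rho>.finite_measure_distr) measurable

lemma measure_\<mu>1_Iic: "measure (\<mu>1 t) {..x} = G (A t x)"
  unfolding \<mu>1_def by (subst measure_distr) (auto simp: vimage_def measure_\<rho>_X)

lemma measure_\<mu>1_Ioc: "a \<le> b \<Longrightarrow> measure (\<mu>1 t) {a<..b} = G (A t b) - G (A t a)"
proof -
  assume "a \<le> b"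
  interpret finite_measure "\<mu>1 t" by (rule finite_\<mu>1)
  have "measure (\<mu>1 t) ({..b} - {..a}) = measure (\<mu>1 t) {..b} - measure (\<mu>1 t) {..a}"
    using \<open>a \<le> b\<close> by (intro finite_measure_Diff) (auto simp: sets_\<mu>1)
  moreover have "{..b} - {..a} = {a<..b}" by auto
  ultimately show ?thesis by (simp add: measure_\<mu>1_Iic)
qed

text \<open>The mass in (a, b] at time t is \<open>G (A t b) - G (A t a)\<close>, at most b - a, so
  the flow never compresses mass beyond density 1.\<close>

lemma \<mu>1_le: "S \<in> sets borel \<Longrightarrow> emeasure (\<mu>1 t) S \<le> emeasure lborel S"
  by (rule emeasure_le_lborel[OF finite_\<mu>1 sets_\<mu>1]) (auto simp: measure_\<mu>1_Ioc G_A_lip)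

subsection \<open>The Eulerian density\<close>

definition flow :: "real \<times> real \<Rightarrow> real \<times> real" where
  "flow = (\<lambda>(t, y). (t, X t y))"

lemma flow_meas [measurable]: "flow \<in> borel \<rightarrow>\<^sub>M borel"
  unfolding flow_def borel_prod[symmetric] by measurable

definition wt :: "real \<times> real \<Rightarrow> real" where
  "wt = (\<lambda>(t, y). indicator {0<..} t * h0 y)"

lemma wt_nonneg: "0 \<le> wt z"
  by (auto simp: wt_def h0_nonneg split: prod.split)

lemma wt_meas [measurable]: "wt \<in> borel_measurable borel"
  unfolding wt_def borel_prod[symmetric] by measurable

text \<open>A measure on space-time instead of one measure per time: a single Radon-Nikodym
  derivative is then measurable in both variables together.\<close>

definition \<mu>2 :: "(real \<times> real) measure" where
  "\<mu>2 = distr (density lborel (\<lambda>z. ennreal (wt z))) borel flow"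

lemma sets_\<mu>2 [measurable_cong]: "sets \<mu>2 = sets borel" and space_\<mu>2 [simp]: "space \<mu>2 = UNIV"
  by (simp_all add: \<mu>2_def)

lemma emeasure_\<mu>2:
  assumes S [measurable]: "S \<in> sets borel"
  shows "emeasure \<mu>2 S = (\<integral>\<^sup>+ t. indicator {0<..} t * emeasure (\<mu>1 t) (Pair t -` S) \<partial>lborel)"
proof -
  have S' [measurable]: "S \<in> sets (borel \<Otimes>\<^sub>M borel)" by (subst borel_prod) (rule S)
  have "flow -` S \<in> sets borel" by (rule measurable_sets_borel[OF flow_meas S])
  then have "emeasure \<mu>2 S = (\<integral>\<^sup>+ z. ennreal (wt z) * indicator S (flow z) \<partial>(lborel \<Otimes>\<^sub>M lborel))"
    unfolding \<mu>2_def lborel_prod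
    by (subst emeasure_distr)
       (auto simp: emeasure_density intro!: nn_integral_cong split: split_indicator)
  also have "\<dots> = (\<integral>\<^sup>+ t. \<integral>\<^sup>+ y. ennreal (wt (t, y)) * indicator S (flow (t, y)) \<partial>lborel \<partial>lborel)"
    by (subst lborel.nn_integral_fst[symmetric]) (auto simp: lborel_prod)
  also have "\<dots> = (\<integral>\<^sup>+ t. indicator {0<..} t * emeasure (\<mu>1 t) (Pair t -` S) \<partial>lborel)"
  proof (intro nn_integral_cong)
    fix t :: real
    have [measurable]: "Pair t -` S \<in> sets borel"
      using measurable_sets_borel[OF _ S, of "Pair t"] by (simp add: borel_measurable_Pair)
    have "(\<integral>\<^sup>+ y. ennreal (wt (t, y)) * indicator S (flow (t, y)) \<partial>lborel)
        = (\<integral>\<^sup>+ y. indicator {0<..} t * (ennreal (h0 y) * indicator (X t -` (Pair t -` S)) y) \<partial>lborel)"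
      by (intro nn_integral_cong) (auto simp: wt_def flow_def split: split_indicator)
    also have "\<dots> = indicator {0<..} t * (\<integral>\<^sup>+ y. (ennreal (h0 y) * indicator (X t -` (Pair t -` S)) y) \<partial>lborel)"
      by (rule nn_integral_cmult) measurable
    also have "(\<integral>\<^sup>+ y. (ennreal (h0 y) * indicator (X t -` (Pair t -` S)) y) \<partial>lborel) = emeasure (\<mu>1 t) (Pair t -` S)"
    proof -
      have "X t -` (Pair t -` S) \<in> sets borel" by (rule measurable_sets_borel[OF X_meas_y]) measurable
      then show ?thesis
        unfolding \<mu>1_def \<rho>_def by (subst emeasure_distr) (auto simp: emeasure_density)
    qed
    finally show "(\<integral>\<^sup>+ y. ennreal (wt (t, y)) * indicator S (flow (t, y)) \<partial>lborel)
        = indicator {0<..} t * emeasure (\<mu>1 t) (Pair t -` S)" .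
  qed
  finally show ?thesis .
qed

lemma emeasure_lborel_sections:
  assumes S: "S \<in> sets (borel :: (real \<times> real) measure)"
  shows "emeasure lborel S = (\<integral>\<^sup>+ t. emeasure lborel (Pair t -` S) \<partial>(lborel :: real measure))"
  unfolding lborel_prod[symmetric]
  by (rule lborel.emeasure_pair_measure_alt) (simp only: lborel_prod sets_lborel S)

lemma \<mu>2_le:
  assumes S: "S \<in> sets borel"
  shows "emeasure \<mu>2 S \<le> emeasure lborel S"
  unfolding emeasure_\<mu>2[OF S] emeasure_lborel_sections[OF S]
proof (intro nn_integral_mono)
  fix t :: real
  have "Pair t -` S \<in> sets borel"
    using measurable_sets_borel[OF _ S, of "Pair t"] by (simp add: borel_measurable_Pair)
  then show "indicator {0<..} t * emeasure (\<mu>1 t) (Pair t -` S) \<le> emeasure lborel (Pair t -` S)"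
    using \<mu>1_le by (auto split: split_indicator)
qed

end

text \<open>A density exceeds 1 only on the union of the sets \<open>T k\<close>, and on each of
  them the excess would make N larger than Lebesgue measure unless the set is null. Truncation then
  gives the bound at every point.\<close>

lemma density_bounded_by_1:
  fixes N :: "'a :: euclidean_space measure"
  assumes sets: "sets N = sets borel"
    and le: "\<And>S. S \<in> sets borel \<Longrightarrow> emeasure N S \<le> emeasure lborel S"
  obtains h :: "'a \<Rightarrow> real" where "h \<in> borel_measurable borel" "\<And>z. 0 \<le> h z" "\<And>z. h z \<le> 1"
    "N = density lborel (\<lambda>z. ennreal (h z))"
proof -
  have "absolutely_continuous lborel N"
    using le unfolding absolutely_continuous_def null_sets_def by (force simp: sets)
  then obtain f where f [measurable]: "f \<in> borel_measurable lborel" and Nf: "density lborel f = N"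
    using sigma_finite_measure.Radon_Nikodym[OF sigma_finite_lborel, of N] sets by auto
  \<comment> \<open>The ball makes the Lebesgue measure of \<open>T k\<close> finite, which permits
    cancelling it.\<close>
  define T where "T k = {z. 1 + ennreal (1 / real (Suc k)) \<le> f z} \<inter> cball 0 (real k)" for k
  have [measurable]: "T k \<in> sets borel" for k unfolding T_def by measurable
  have "emeasure lborel (T k) = 0" for k
  proof -
    have fin: "emeasure lborel (T k) < \<infinity>"
      using emeasure_mono[of "T k" "cball 0 (real k)" lborel] emeasure_lborel_cball_finite[of "0::'a" "real k"]
      by (auto simp: T_def intro: order_le_less_trans)
    have "(1 + ennreal (1 / real (Suc k))) * emeasure lborel (T k)
        = (\<integral>\<^sup>+ z. (1 + ennreal (1 / real (Suc k))) * indicator (T k) z \<partial>lborel)"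
      by (simp add: nn_integral_cmult_indicator)
    also have "\<dots> \<le> (\<integral>\<^sup>+ z. f z * indicator (T k) z \<partial>lborel)"
      by (intro nn_integral_mono) (auto simp: T_def split: split_indicator)
    also have "\<dots> = emeasure N (T k)" by (simp add: Nf[symmetric] emeasure_density)
    also have "\<dots> \<le> emeasure lborel (T k)" by (rule le) measurable
    finally have "emeasure lborel (T k) + ennreal (1 / real (Suc k)) * emeasure lborel (T k)
        \<le> emeasure lborel (T k) + 0" by (simp add: distrib_right)
    then have "ennreal (1 / real (Suc k)) * emeasure lborel (T k) \<le> 0"
      using fin by (subst (asm) ennreal_add_left_cancel_le) auto
    then show ?thesis by (simp add: divide_eq_0_iff)
  qed
  then have "AE z in lborel. \<forall>k. z \<notin> T k"
    unfolding AE_all_countable by (intro allI AE_not_in) (auto simp: null_sets_def)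
  then have le1: "AE z in lborel. f z \<le> 1"
  proof eventually_elim
    case (elim z)
    show "f z \<le> 1"
    proof (rule ccontr)
      assume "\<not> f z \<le> 1"
      then have "1 < f z" by simp
      then obtain e :: real where e: "0 < e" "1 + ennreal e \<le> f z"
      proof (cases "f z")
        case (real x)
        then have "1 < x" using \<open>1 < f z\<close> by (metis ennreal_1 ennreal_less_iff zero_le_one)
        then show ?thesis using that[of "x - 1"] real by (simp flip: ennreal_1 ennreal_plus)
      qed (auto intro: that[of 1])
      obtain k where "1 / e \<le> real k" "norm z \<le> real k"
        using real_arch_simple[of "max (1 / e) (norm z)"] by auto
      then have "1 / real (Suc k) \<le> e"
        using e by (simp add: field_simps)
      then have "1 + ennreal (1 / real (Suc k)) \<le> f z"
        using e(2) by (meson add_left_mono ennreal_leI order_trans)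
      then have "z \<in> T k" using \<open>norm z \<le> real k\<close> by (simp add: T_def)
      then show False using elim by blast
    qed
  qed
  define h where "h z = min 1 (enn2real (f z))" for z
  show ?thesis
  proof
    show "h \<in> borel_measurable borel" unfolding h_def by measurable
    show "0 \<le> h z" "h z \<le> 1" for z by (auto simp: h_def)
    show "N = density lborel (\<lambda>z. ennreal (h z))"
      unfolding Nf[symmetric]
    proof (rule density_cong)
      show "AE z in lborel. f z = ennreal (h z)"
        using le1
      proof eventually_elim
        case (elim z)
        then have "f z < \<infinity>" by (auto intro: order_le_less_trans)
        moreover have "enn2real (f z) \<le> 1" using enn2real_mono[OF elim] by simp
        ultimately show ?case by (simp add: h_def)
      qed
    qed (auto simp: h_def)
  qed
qed

context follow_the_leader
begin

text \<open>One version of the density is fixed, with values in [0, 1] at every point, because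
  velocity and pressure are defined by cases on \<open>h z = 1\<close>.\<close>

definition h :: "real \<times> real \<Rightarrow> real" where
  "h = (SOME h. h \<in> borel_measurable borel \<and> (\<forall>z. 0 \<le> h z) \<and> (\<forall>z. h z \<le> 1) \<and>
         \<mu>2 = density lborel (\<lambda>z. ennreal (h z)))"

lemma h_meas [measurable]: "h \<in> borel_measurable borel"
  and h_nonneg: "0 \<le> h z" and h_le_1: "h z \<le> 1"
  and \<mu>2_eq: "\<mu>2 = density lborel (\<lambda>z. ennreal (h z))"
proof -
  have "\<exists>h. h \<in> borel_measurable borel \<and> (\<forall>z. 0 \<le> h z) \<and> (\<forall>z. h z \<le> 1) \<and>
         \<mu>2 = density lborel (\<lambda>z. ennreal (h z))"
    by (rule density_bounded_by_1[OF sets_\<mu>2 \<mu>2_le]) auto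
  note * = someI_ex[OF this]
  show "h \<in> borel_measurable borel" "0 \<le> h z" "h z \<le> 1"
    "\<mu>2 = density lborel (\<lambda>z. ennreal (h z))"
    using * unfolding h_def[symmetric] by blast+
qed

lemma transport_integral:
  fixes F :: "real \<times> real \<Rightarrow> real"
  assumes [measurable]: "F \<in> borel_measurable borel"
  shows "(LINT z|lborel. h z * F z) = (LINT w|lborel. wt w * F (flow w))"
    and "integrable lborel (\<lambda>z. h z * F z) \<longleftrightarrow> integrable lborel (\<lambda>w. wt w * F (flow w))"
proof -
  have "(LINT z|lborel. h z * F z) = integral\<^sup>L \<mu>2 F"
    unfolding \<mu>2_eq by (subst integral_density) (auto simp: h_nonneg)
  also have "\<dots> = (LINT w|lborel. wt w * F (flow w))"
    unfolding \<mu>2_def by (subst integral_distr) (auto simp: integral_density wt_nonneg)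
  finally show "(LINT z|lborel. h z * F z) = (LINT w|lborel. wt w * F (flow w))" .
  have "integrable lborel (\<lambda>z. h z * F z) \<longleftrightarrow> integrable \<mu>2 F"
    unfolding \<mu>2_eq by (subst integrable_density) (auto simp: h_nonneg)
  also have "\<dots> \<longleftrightarrow> integrable lborel (\<lambda>w. wt w * F (flow w))"
    unfolding \<mu>2_def by (subst integrable_distr_eq) (auto simp: integrable_density wt_nonneg)
  finally show "integrable lborel (\<lambda>z. h z * F z) \<longleftrightarrow> integrable lborel (\<lambda>w. wt w * F (flow w))" .
qed

text \<open>As \<mu>2 is below Lebesgue measure, a null set in space-time is also \<mu>2-null; its
  preimage under the flow is then negligible wherever the weight \<open>wt\<close> is
  positive.\<close>

lemma transport_AE:
  assumes "AE z in lborel. Q z"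
  shows "AE w in lborel. 0 < fst w \<and> 0 < h0 (snd w) \<longrightarrow> Q (flow w)"
proof -
  obtain N where N: "N \<in> null_sets lborel" "{z. \<not> Q z} \<subseteq> N"
    using assms unfolding eventually_ae_filter by auto
  then have "emeasure \<mu>2 N = 0" using \<mu>2_le[of N] N(1) by (simp add: null_sets_def)
  then have "N \<in> null_sets \<mu>2" using N(1) by (auto simp: null_sets_def sets_\<mu>2)
  then have "AE z in \<mu>2. z \<notin> N" by (rule AE_not_in)
  then have "AE z in density lborel (\<lambda>z. ennreal (wt z)). flow z \<notin> N"
    unfolding \<mu>2_def using N(1) by (subst (asm) AE_distr_iff) auto
  then have "AE z in lborel. 0 < wt z \<longrightarrow> flow z \<notin> N"
    by (subst (asm) AE_density) auto
  then show ?thesis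
    by eventually_elim (use N(2) in \<open>auto simp: wt_def split: prod.splits\<close>)
qed

text \<open>Position minus mass behind it, the Eulerian counterpart of \<open>Y\<close>: at
  \<open>X t y\<close> it equals \<open>Y t y\<close> whenever \<open>A\<close> recovers the label
  y. Its increments measure unoccupied length, so it is constant across packed stretches.\<close>

definition gap :: "real \<Rightarrow> real \<Rightarrow> real" where
  "gap t x = x - G (A t x)"

lemma gap_mono: "x \<le> x' \<Longrightarrow> gap t x \<le> gap t x'"
  using G_A_lip[of x x' t] by (simp add: gap_def)

lemma gap_meas [measurable (raw)]:
  assumes [measurable]: "f \<in> borel_measurable M" "g \<in> borel_measurable M"
  shows "(\<lambda>w. gap (f w) (g w)) \<in> borel_measurable M"
  unfolding gap_def by measurable

text \<open>The set is an interval ending at c. From any of its points x to c the mass equals c - x,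
  and letting x decrease to the infimum gives at least the full length.\<close>

lemma \<mu>1_flat:
  assumes E: "E = {x. x < c \<and> gap t x = gap t c}"
  shows "emeasure (\<mu>1 t) E = emeasure lborel E"
proof (cases "E = {}")
  case False
  interpret finite_measure "\<mu>1 t" by (rule finite_\<mu>1)
  have E_meas [measurable]: "E \<in> sets borel" unfolding E by measurable
  have G_nonneg: "0 \<le> G y" for y
    unfolding G_def set_lebesgue_integral_def by (simp add: h0_nonneg)
  \<comment> \<open>Since G \<ge> 0, the gap never exceeds the position; this bounds E from
    below.\<close>
  have low: "gap t c \<le> x" if "x \<in> E" for x
    using that G_nonneg[of "A t x"] by (auto simp: E gap_def)
  have bdd: "bdd_below E" using low by (rule bdd_belowI)
  have up: "E \<subseteq> {Inf E..c}" using cInf_lower[OF _ bdd] by (auto simp: E)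
  have "c - x \<le> measure (\<mu>1 t) E" if "x \<in> E" for x
  proof -
    have x: "x < c" "gap t x = gap t c" using that by (auto simp: E)
    have "emeasure (\<mu>1 t) {c} = 0" using \<mu>1_le[of "{c}" t] by simp
    then have c0: "measure (\<mu>1 t) {c} = 0" by (simp add: measure_def)
    have "c - x = measure (\<mu>1 t) {x<..c}" using x by (simp add: measure_\<mu>1_Ioc gap_def)
    also have "\<dots> \<le> measure (\<mu>1 t) (E \<union> {c})"
    proof (rule finite_measure_mono)
      show "{x<..c} \<subseteq> E \<union> {c}"
      proof
        fix z assume z: "z \<in> {x<..c}"
        then have "gap t x \<le> gap t z" "gap t z \<le> gap t c" by (auto intro: gap_mono)
        then show "z \<in> E \<union> {c}" using x z by (auto simp: E)
      qed
    qed (auto simp: sets_\<mu>1)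
    also have "\<dots> \<le> measure (\<mu>1 t) E + measure (\<mu>1 t) {c}"
      by (rule measure_Un_le) (auto simp: sets_\<mu>1)
    finally show ?thesis using c0 by simp
  qed
  then have "c - measure (\<mu>1 t) E \<le> Inf E"
    using False by (intro cInf_greatest) (auto simp: algebra_simps)
  moreover have "Inf E \<le> c" using False up by fastforce
  moreover have "emeasure lborel E \<le> emeasure lborel {Inf E..c}" using up by (intro emeasure_mono) auto
  ultimately have "emeasure lborel E \<le> emeasure (\<mu>1 t) E"
    by (simp add: emeasure_eq_measure) (smt (verit) ennreal_leI order_trans)
  then show ?thesis using \<mu>1_le[OF E_meas, of t] by (simp add: antisym)
qed simp

text \<open>On a packed stretch \<mu>2 and Lebesgue measure agree, so the nonnegative function 1 - h
  has integral 0 there. Rational right ends c leave countably many exceptional sets.\<close>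

lemma h_flat: "AE z in lborel. 0 < fst z \<longrightarrow> (\<forall>c\<in>\<rat>. snd z < c \<longrightarrow> gap (fst z) (snd z) = gap (fst z) c \<longrightarrow> h z = 1)"
proof -
  have *: "AE z in lborel. z \<in> E \<longrightarrow> h z = 1"
    if E: "E = {z. 0 < fst z \<and> fst z < T \<and> snd z < c \<and> gap (fst z) (snd z) = gap (fst z) c}" for E T c
  proof -
    have "Measurable.pred (borel \<Otimes>\<^sub>M borel)
        (\<lambda>z. 0 < fst z \<and> fst z < T \<and> snd z < c \<and> gap (fst z) (snd z) = gap (fst z) c)"
      by measurable
    then have [measurable]: "E \<in> sets borel"
      unfolding borel_prod pred_def E by simp
    have sec: "Pair t -` E = (if 0 < t \<and> t < T then {x. x < c \<and> gap t x = gap t c} else {})" for t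
      by (auto simp: E)
    have eq: "emeasure \<mu>2 E = emeasure lborel E"
      unfolding emeasure_\<mu>2[OF \<open>E \<in> sets borel\<close>] emeasure_lborel_sections[OF \<open>E \<in> sets borel\<close>]
      by (intro nn_integral_cong) (auto simp: sec \<mu>1_flat split: split_indicator)
    \<comment> \<open>Finiteness allows the later subtraction: each section of E has length equal to
      its mass, at most the total mass, and T bounds the time.\<close>
    have "emeasure lborel E \<le> (\<integral>\<^sup>+ t. emeasure \<rho> UNIV * indicator {0..T} t \<partial>(lborel :: real measure))"
      unfolding emeasure_lborel_sections[OF \<open>E \<in> sets borel\<close>]
    proof (intro nn_integral_mono)
      fix t :: real
      have "emeasure (\<mu>1 t) S \<le> emeasure \<rho> UNIV" for S
        using emeasure_space[of "\<mu>1 t" S] unfolding \<mu>1_def by (simp add: emeasure_distr)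
      then show "emeasure lborel (Pair t -` E) \<le> emeasure \<rho> UNIV * indicator {0..T} t"
        by (auto simp: sec \<mu>1_flat[symmetric])
    qed
    also have "\<dots> < \<infinity>"
      by (simp add: nn_integral_cmult_indicator ennreal_mult_eq_top_iff emeasure_lborel_Icc_eq less_top[symmetric])
    finally have fin: "emeasure lborel E < \<infinity>" .
    have "(\<integral>\<^sup>+ z. ennreal (1 - h z) * indicator E z \<partial>lborel) + emeasure lborel E
        = (\<integral>\<^sup>+ z. ennreal (1 - h z) * indicator E z \<partial>lborel) + (\<integral>\<^sup>+ z. ennreal (h z) * indicator E z \<partial>lborel)"
      unfolding eq[symmetric] \<mu>2_eq by (simp add: emeasure_density)
    also have "\<dots> = (\<integral>\<^sup>+ z. indicator E z \<partial>lborel)"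
    proof (subst nn_integral_add[symmetric])
      show "(\<integral>\<^sup>+ z. ennreal (1 - h z) * indicator E z + ennreal (h z) * indicator E z \<partial>lborel)
          = (\<integral>\<^sup>+ z. indicator E z \<partial>lborel)"
        by (intro nn_integral_cong)
           (auto simp: h_nonneg h_le_1 simp flip: ennreal_plus split: split_indicator)
    qed auto
    also have "\<dots> = emeasure lborel E" by simp
    finally have "(\<integral>\<^sup>+ z. ennreal (1 - h z) * indicator E z \<partial>lborel) = 0"
      using fin by (cases "\<integral>\<^sup>+ z. ennreal (1 - h z) * indicator E z \<partial>lborel" rule: ennreal_cases;
                    cases "emeasure lborel E" rule: ennreal_cases)
                   (auto simp flip: ennreal_plus)
    then have "AE z in lborel. ennreal (1 - h z) * indicator E z = 0"
      by (subst (asm) nn_integral_0_iff_AE) auto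
    then show ?thesis
      by eventually_elim (use h_le_1 in \<open>auto simp: ennreal_eq_0_iff antisym split: split_indicator_asm\<close>)
  qed
  have "AE z in lborel. \<forall>n::nat. \<forall>c\<in>\<rat>. 0 < fst z \<and> fst z < real n \<and> snd z < c \<and> gap (fst z) (snd z) = gap (fst z) c \<longrightarrow> h z = 1"
    unfolding AE_all_countable
  proof (rule allI, subst AE_ball_countable[OF countable_rat], intro ballI)
    fix n :: nat and c :: real
    show "AE z in lborel. 0 < fst z \<and> fst z < real n \<and> snd z < c \<and> gap (fst z) (snd z) = gap (fst z) c \<longrightarrow> h z = 1"
      using *[OF refl, of "real n" c] by simp
  qed
  then show ?thesis
    by eventually_elim (use reals_Archimedean2 in blast)
qed

text \<open>Labels with no mass immediately ahead. Every other label is recovered from its position,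
  since cars further ahead are then strictly separated from it.\<close>

definition dead :: "real \<Rightarrow> bool" where
  "dead y \<longleftrightarrow> (\<exists>q>y. G q = G y)"

lemma dead_iff_rat: "dead y \<longleftrightarrow> (\<exists>q\<in>\<rat>. y < q \<and> G q = G y)"
proof
  assume "dead y"
  then obtain q where q: "q > y" "G q = G y" by (auto simp: dead_def)
  obtain q' where q': "q' \<in> \<rat>" "y < q'" "q' < q" using Rats_dense_in_real[OF q(1)] by auto
  then have "G q' = G y" using G_mono[of y q'] G_mono[of q' q] q by auto
  then show "\<exists>q\<in>\<rat>. y < q \<and> G q = G y" using q' by auto
qed (auto simp: dead_def)

text \<open>For fixed q the labels below q with the same value of G form an interval up to q, on
  which h0 vanishes almost everywhere. Rational starting points exhaust it except for its infimum,
  and rational q exhaust the dead labels.\<close>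

lemma AE_dead: "AE y in lborel. 0 < h0 y \<longrightarrow> \<not> dead y"
proof -
  have *: "AE y in lborel. y < q \<longrightarrow> G q = G y \<longrightarrow> h0 y = 0" for q
  proof -
    define D where "D = {y. y < q \<and> G q = G y}"
    have flat: "AE y in lborel. y \<in> {a<..q} \<longrightarrow> h0 y = 0" if "a \<in> D" for a
    proof -
      have "(LINT x:{a<..q}|lborel. h0 x) = 0" using that G_diff[of a q] by (simp add: D_def)
      then have "AE x in lborel. indicator {a<..q} x *\<^sub>R h0 x = 0"
        unfolding set_lebesgue_integral_def using h0_set_int[of "{a<..q}"]
        by (subst (asm) integral_nonneg_eq_0_iff_AE) (auto simp: set_integrable_def h0_nonneg)
      then show ?thesis by eventually_elim (auto split: split_indicator_asm)
    qed
    have "\<exists>a\<in>\<rat> \<inter> D. a < y" if "y \<in> D" "y \<noteq> Inf D" for y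
    proof -
      have "\<exists>d\<in>D. d < y"
        using that by (metis cInf_eq_minimum linorder_not_less)
      then obtain d where d: "d \<in> D" "d < y" by auto
      obtain a where a: "a \<in> \<rat>" "d < a" "a < y" using Rats_dense_in_real[OF d(2)] by auto
      then have "a \<in> D" using d that G_mono[of d a] G_mono[of a y] by (auto simp: D_def)
      then show ?thesis using a by auto
    qed note left = this
    have "AE y in lborel. \<forall>a\<in>\<rat> \<inter> D. y \<in> {a<..q} \<longrightarrow> h0 y = 0"
      by (subst AE_ball_countable) (auto intro: countable_Int1 countable_rat flat simp del: greaterThanAtMost_iff)
    then show ?thesis
      using AE_lborel_singleton[of "Inf D"]
    proof eventually_elim
      case (elim y)
      show ?case
      proof (intro impI)
        assume "y < q" "G q = G y"
        then show "h0 y = 0" using left[of y] elim by (auto simp: D_def)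
      qed
    qed
  qed
  have "AE y in lborel. \<forall>q\<in>\<rat>. y < q \<longrightarrow> G q = G y \<longrightarrow> h0 y = 0"
    using * by (subst AE_ball_countable) (auto simp: countable_rat)
  then show ?thesis
    by eventually_elim (metis dead_iff_rat less_irrefl)
qed

end

subsection \<open>Weak formulation\<close>

text \<open>A fundamental theorem of calculus using left derivatives only. For the extension
  \<open>K\<close> of f by zero, the integral of K t - K (t - d) vanishes by translation invariance;
  dominated convergence of the quotients leaves only the jump at 0.\<close>

lemma integral_left_derivative:
  fixes f g :: "real \<Rightarrow> real"
  assumes lip: "\<And>s t. 0 \<le> s \<Longrightarrow> s \<le> t \<Longrightarrow> \<bar>f t - f s\<bar> \<le> L * (t - s)"
    and lim: "\<And>t. 0 < t \<Longrightarrow> (\<lambda>k. (f t - f (t - 1 / real (Suc k))) * real (Suc k)) \<longlonglongrightarrow> g t"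
    and zero: "\<And>t. T \<le> t \<Longrightarrow> f t = 0" and T: "0 < T"
  shows "(LINT t|lborel. indicator {0<..} t * g t) = - f 0"
proof -
  define K where "K t = indicator {0<..} t * f t" for t
  define d where "d k = 1 / real (Suc k)" for k
  have d: "0 < d k" "d k \<le> 1" "real (Suc k) = 1 / d k" for k by (auto simp: d_def)
  \<comment> \<open>K jumps by f 0 at time 0, which would make the quotients unbounded on (0, d k].
    The last term removes the jump and contributes exactly - f 0 to the integral.\<close>
  define q where "q k t = (K t - K (t - d k) - f 0 * indicator {0<..d k} t) * real (Suc k)" for k t
  have L: "0 \<le> L" using order_trans[OF abs_ge_zero lip[of 0 1]] by simp
  have "continuous_on {0..} f"
  proof (rule lipschitz_on_continuous_on)
    show "L-lipschitz_on {0..} f"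
    proof (rule lipschitz_onI)
      fix a b :: real assume "a \<in> {0..}" "b \<in> {0..}"
      then show "dist (f a) (f b) \<le> L * dist a b"
        using lip[of a b] lip[of b a] by (cases "a \<le> b") (auto simp: dist_real_def abs_minus_commute)
    qed (rule L)
  qed
  then have "continuous_on {0<..} f" by (rule continuous_on_subset) auto
  then have K_meas [measurable]: "K \<in> borel_measurable borel"
    unfolding K_def using borel_measurable_continuous_on_indicator[of "{0<..}" f] by simp
  have K_out: "K t = 0" if "t \<notin> {0..T}" for t using that zero[of t] by (auto simp: K_def)
  have "\<bar>K t\<bar> \<le> L * T" for t
    using lip[of t T] zero[of T] T L mult_left_mono[of "T - t" T L]
    by (cases "t \<in> {0<..T}") (auto simp: K_def zero)
  then have K_int: "integrable lborel K"
    using K_out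
    by (intro integrableI_bounded_set[where A="{0..T}" and B="L * T"]) (auto simp: emeasure_lborel_Icc_eq)
  have K_shift: "integrable lborel (\<lambda>t. K (t - d k))" "(LINT t|lborel. K (t - d k)) = (LINT t|lborel. K t)" for k
    using lborel_integrable_real_affine[OF K_int, of 1 "- d k"] lborel_integral_real_affine[of 1 K "- d k"]
    by (auto simp: algebra_simps)
  have int_q: "(LINT t|lborel. q k t) = - f 0" for k
    unfolding q_def using K_int K_shift d[of k] by (simp add: integrable_diff)
  have bound: "norm (q k t) \<le> L * indicator {0..T + 1} t" for k t
  proof -
    consider "t \<le> 0" | "0 < t" "t \<le> d k" | "d k < t" "t \<le> T + 1" | "T + 1 < t" "d k < t" 
      using d[of k] T by fastforce
    then have "\<bar>K t - K (t - d k) - f 0 * indicator {0<..d k} t\<bar> \<le> L * d k * indicator {0..T + 1} t"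
    proof cases
      case 1 then show ?thesis using d(1)[of k] L by (auto simp: K_def)
    next
      case 2
      then have "\<bar>f t - f 0\<bar> \<le> L * d k" using lip[of 0 t] L mult_left_mono[of t "d k" L] by auto
      moreover have "t \<le> T + 1" using 2 d(2)[of k] T by linarith
      ultimately show ?thesis using 2 by (auto simp: K_def)
    next
      case 3 then show ?thesis using d(1)[of k] lip[of "t - d k" t] by (auto simp: K_def)
    next
      case 4 then show ?thesis using d(1,2)[of k] zero[of t] zero[of "t - d k"] T by (auto simp: K_def)
    qed
    then have "\<bar>K t - K (t - d k) - f 0 * indicator {0<..d k} t\<bar> * real (Suc k)
        \<le> L * d k * indicator {0..T + 1} t * real (Suc k)"
      by (rule mult_right_mono) simp
    moreover have "L * d k * indicator {0..T + 1} t * real (Suc k) = L * indicator {0..T + 1} t"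
      by (simp add: d_def del: of_nat_Suc)
    ultimately show ?thesis by (simp add: q_def abs_mult del: of_nat_Suc)
  qed
  have "(\<lambda>k. LINT t|lborel. q k t) \<longlonglongrightarrow> (LINT t|lborel. indicator {0<..} t * g t)"
  proof (rule integral_dominated_convergence[where w="\<lambda>t. L * indicator {0..T + 1} t"])
    have pt: "(\<lambda>k. q k t) \<longlonglongrightarrow> indicator {0<..} t * g t" for t
    proof (cases "0 < t")
      case True
      have "d \<longlonglongrightarrow> 0" unfolding d_def by (rule LIMSEQ_Suc[OF lim_1_over_n])
      then have "eventually (\<lambda>k. d k < t) sequentially" using True by (rule order_tendstoD)
      then have "eventually (\<lambda>k. (f t - f (t - d k)) * real (Suc k) = q k t) sequentially"
        by eventually_elim (use True in \<open>auto simp: q_def K_def\<close>)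
      moreover have "(\<lambda>k. (f t - f (t - d k)) * real (Suc k)) \<longlonglongrightarrow> g t"
        using lim[OF True] by (simp add: d_def)
      ultimately have "(\<lambda>k. q k t) \<longlonglongrightarrow> g t" by (rule Lim_transform_eventually[rotated])
      then show ?thesis using True by simp
    next
      case False
      then have "q k t = 0" for k using bound[of k t] T d(1)[of k] by (auto simp: q_def K_def)
      then show ?thesis using False by simp
    qed
    then show "AE t in lborel. (\<lambda>k. q k t) \<longlonglongrightarrow> indicator {0<..} t * g t" by simp
    show q_meas: "q k \<in> borel_measurable lborel" for k unfolding q_def by measurable
    show "(\<lambda>t. indicator {0<..} t * g t) \<in> borel_measurable lborel"
      by (rule borel_measurable_LIMSEQ_real[OF pt q_meas])
  qed (use bound in \<open>auto simp: emeasure_lborel_Icc_eq\<close>)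
  then show ?thesis unfolding int_q using LIMSEQ_unique tendsto_const by blast
qed

text \<open>Replaces the derivatives by bounded Borel functions on the whole plane that vanish for t
  < 0 and outside a box, so that integrability questions become trivial.\<close>

lemma test_function_derivatives:
  assumes \<phi>: "\<phi> \<in> test_functions"
  obtains g k :: "real \<times> real \<Rightarrow> real" and C R :: real
  where "g \<in> borel_measurable borel" "k \<in> borel_measurable borel"
    "\<And>z. \<bar>g z\<bar> \<le> C" "\<And>z. \<bar>k z\<bar> \<le> C" "0 < R"
    "\<And>t x. R < \<bar>t\<bar> \<or> R < \<bar>x\<bar> \<Longrightarrow> g (t, x) = 0 \<and> k (t, x) = 0"
    "\<And>t x. 0 \<le> t \<Longrightarrow> R < t \<Longrightarrow> \<phi> (t, x) = 0"
    "\<And>z. z \<in> half_plane \<Longrightarrow> (\<phi> has_derivative (\<lambda>(s, y). s * g z + y * k z)) (at z within half_plane)"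
proof -
  from \<phi> have "Ck_half_plane (Suc 0) \<phi>" and comp: "compact (closure {z \<in> half_plane. \<phi> z \<noteq> 0})"
    unfolding test_functions_def by blast+
  then obtain g0 k0 where
    der: "\<And>z. z \<in> half_plane \<Longrightarrow> (\<phi> has_derivative (\<lambda>(s, y). s * g0 z + y * k0 z)) (at z within half_plane)"
    and cont: "continuous_on half_plane g0" "continuous_on half_plane k0"
    by auto
  obtain R0 where R0: "\<And>z. z \<in> closure {z \<in> half_plane. \<phi> z \<noteq> 0} \<Longrightarrow> norm z \<le> R0"
    using compact_imp_bounded[OF comp] unfolding bounded_iff by auto
  define R where "R = max R0 1"
  have out: "\<phi> (t, x) = 0" if "0 \<le> t" "R < \<bar>t\<bar> \<or> R < \<bar>x\<bar>" for t x
  proof (rule ccontr)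
    assume "\<phi> (t, x) \<noteq> 0"
    then have "(t, x) \<in> closure {z \<in> half_plane. \<phi> z \<noteq> 0}"
      using that(1) by (intro subsetD[OF closure_subset]) (simp add: half_plane_def)
    from R0[OF this] have "norm (t, x) \<le> R" by (simp add: R_def)
    moreover have "\<bar>t\<bar> \<le> norm (t, x)" "\<bar>x\<bar> \<le> norm (t, x)"
      using norm_fst_le[of t x] norm_snd_le[of x t] by auto
    ultimately show False using that by linarith
  qed
  have der_pos: "g0 (t, x) = 0 \<and> k0 (t, x) = 0" if "0 < t" "R < \<bar>t\<bar> \<or> R < \<bar>x\<bar>" for t x
  proof -
    define U where "U = {z :: real \<times> real. 0 < fst z \<and> (R < \<bar>fst z\<bar> \<or> R < \<bar>snd z\<bar>)}"
    have "open U" unfolding U_def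
      by (intro open_Collect_conj open_Collect_disj open_Collect_less continuous_intros)
    have U: "(t, x) \<in> U" "U \<subseteq> half_plane" using that by (auto simp: half_plane_def U_def)
    have "(\<phi> has_derivative (\<lambda>(s, y). s * g0 (t, x) + y * k0 (t, x))) (at (t, x))"
      using has_derivative_subset[OF der[OF subsetD[OF U(2,1)]] U(2)] at_within_open[OF U(1) \<open>open U\<close>] by simp
    then have "((\<lambda>z. 0) has_derivative (\<lambda>(s, y). s * g0 (t, x) + y * k0 (t, x))) (at (t, x))"
    proof (rule has_derivative_transform_within_open[OF _ \<open>open U\<close> U(1)])
      fix w assume "w \<in> U"
      then show "\<phi> w = 0" using out[of "fst w" "snd w"] by (auto simp: U_def)
    qed
    then have "(\<lambda>(s, y). s * g0 (t, x) + y * k0 (t, x)) = (\<lambda>w. 0)"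
      by (rule has_derivative_unique) simp
    from fun_cong[OF this, of "(1, 0)"] fun_cong[OF this, of "(0, 1)"] show ?thesis by simp
  qed
  \<comment> \<open>On the line t = 0 the derivatives vanish by continuity from t > 0, where the
    derivative is two-sided and therefore unique.\<close>
  have der_out: "g0 (t, x) = 0 \<and> k0 (t, x) = 0" if "0 \<le> t" "R < \<bar>t\<bar> \<or> R < \<bar>x\<bar>" for t x
  proof (cases "t = 0")
    case True
    have lim0: "f (0, x) = 0" if f: "continuous_on half_plane f" "\<And>s. 0 < s \<Longrightarrow> f (s, x) = 0"
      for f :: "real \<times> real \<Rightarrow> real"
    proof -
      have "(\<lambda>n. (1 / real (Suc n), x)) \<longlonglongrightarrow> (0, x)"
        by (intro tendsto_Pair tendsto_const LIMSEQ_Suc[OF lim_1_over_n])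
      then have "(\<lambda>n. f (1 / real (Suc n), x)) \<longlonglongrightarrow> f (0, x)"
        by (rule continuous_on_tendsto_compose[OF f(1)]) (auto simp: half_plane_def)
      moreover have "f (1 / real (Suc n), x) = 0" for n by (rule f(2)) simp
      ultimately show ?thesis by (simp add: LIMSEQ_const_iff)
    qed
    have "R < \<bar>x\<bar>" using that True by (auto simp: R_def)
    then show ?thesis using lim0[OF cont(1)] lim0[OF cont(2)] der_pos True by auto
  qed (use der_pos that in auto)
  define B where "B = {0..R} \<times> {-R..R}"
  have "compact B" unfolding B_def by (intro compact_Times compact_Icc)
  have "B \<subseteq> half_plane" by (auto simp: B_def half_plane_def)
  have bnd: "\<exists>C. \<forall>z\<in>B. \<bar>f z\<bar> \<le> C" if "continuous_on half_plane f" for f :: "real \<times> real \<Rightarrow> real"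
    using compact_imp_bounded[OF compact_continuous_image[OF continuous_on_subset[OF that \<open>B \<subseteq> half_plane\<close>] \<open>compact B\<close>]]
    unfolding bounded_iff by auto
  obtain C1 C2 where C: "\<And>z. z \<in> B \<Longrightarrow> \<bar>g0 z\<bar> \<le> C1" "\<And>z. z \<in> B \<Longrightarrow> \<bar>k0 z\<bar> \<le> C2"
    using bnd[OF cont(1)] bnd[OF cont(2)] by auto
  have hp: "half_plane \<in> sets borel"
    unfolding half_plane_def by (intro borel_closed closed_Times) auto
  show ?thesis
  proof (rule that[of "\<lambda>z. indicator half_plane z *\<^sub>R g0 z" "\<lambda>z. indicator half_plane z *\<^sub>R k0 z" "max 0 (max C1 C2)" R])
    show "(\<lambda>z. indicator half_plane z *\<^sub>R g0 z) \<in> borel_measurable borel"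
      "(\<lambda>z. indicator half_plane z *\<^sub>R k0 z) \<in> borel_measurable borel"
      by (rule borel_measurable_continuous_on_indicator[OF hp cont(1)],
          rule borel_measurable_continuous_on_indicator[OF hp cont(2)])
    fix z :: "real \<times> real"
    have "z \<in> B \<or> z \<notin> half_plane \<or> (g0 z = 0 \<and> k0 z = 0)"
      using der_out[of "fst z" "snd z"] by (cases z) (force simp: B_def half_plane_def)
    then show "\<bar>indicator half_plane z *\<^sub>R g0 z\<bar> \<le> max 0 (max C1 C2)"
      "\<bar>indicator half_plane z *\<^sub>R k0 z\<bar> \<le> max 0 (max C1 C2)"
      using C[of z] by (auto split: split_indicator)
  next
    show "0 < R" by (simp add: R_def)
    fix t x :: real assume "R < \<bar>t\<bar> \<or> R < \<bar>x\<bar>"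
    then show "indicator half_plane (t, x) *\<^sub>R g0 (t, x) = 0 \<and> indicator half_plane (t, x) *\<^sub>R k0 (t, x) = 0"
      using der_out[of t x] by (auto simp: half_plane_def split: split_indicator)
  next
    fix z assume "z \<in> half_plane"
    then show "(\<phi> has_derivative (\<lambda>(s, y). s * (indicator half_plane z *\<^sub>R g0 z) + y * (indicator half_plane z *\<^sub>R k0 z)))
       (at z within half_plane)" using der[of z] by simp
  qed (use out in auto)
qed

context follow_the_leader
begin

text \<open>Chain rule along a curve with left derivatives: the differentiability error is relative
  to the distance in the plane, and that distance is at most 1 + V times the time step.\<close>

lemma flow_derivative:
  assumes der: "(\<phi> has_derivative (\<lambda>(s, x). s * a + x * b)) (at (t, X t y))"
  shows "(\<lambda>k. (\<phi> (t, X t y) - \<phi> (t - 1 / real (Suc k), X (t - 1 / real (Suc k)) y)) * real (Suc k))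
           \<longlonglongrightarrow> a + uL t y * b"
proof -
  define d where "d k = 1 / real (Suc k)" for k
  define z where "z = (t, X t y)"
  define w where "w k = (t - d k, X (t - d k) y)" for k
  define D where "D = (\<lambda>(s, x). s * a + x * b :: real)"
  define e where "e k = (\<phi> (w k) - \<phi> z - D (w k - z)) / norm (w k - z)" for k
  have d: "d \<longlonglongrightarrow> 0" "0 < d k" for k unfolding d_def by (rule LIMSEQ_Suc[OF lim_1_over_n]) simp
  have "(\<lambda>k. X (t - d k) y) \<longlonglongrightarrow> X (t - 0) y"
    using X_cont_t[of UNIV y] by (intro continuous_on_tendsto_compose[OF _ tendsto_diff[OF tendsto_const d(1)]]) auto
  then have "w \<longlonglongrightarrow> z"
    unfolding w_def z_def by (intro tendsto_Pair) (auto intro!: tendsto_eq_intros d)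
  moreover have wz: "w k \<noteq> z" for k using d(2)[of k] by (simp add: w_def z_def)
  ultimately have "filterlim w (at z) sequentially"
    by (intro filterlim_atI) auto
  moreover have "((\<lambda>v. (\<phi> v - \<phi> z - D (v - z)) / norm (v - z)) \<longlongrightarrow> 0) (at z)"
  proof (rule tendsto_norm_zero_cancel)
    have "((\<lambda>v. norm (\<phi> v - \<phi> z - D (v - z)) / norm (v - z)) \<longlongrightarrow> 0) (at z)"
      using der unfolding has_derivative_iff_norm z_def[symmetric] D_def[symmetric] by blast
    then show "((\<lambda>v. norm ((\<phi> v - \<phi> z - D (v - z)) / norm (v - z))) \<longlongrightarrow> 0) (at z)"
      by (simp only: abs_divide real_norm_def abs_norm_cancel)
  qed
  ultimately have e0: "e \<longlonglongrightarrow> 0"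
    unfolding e_def by (rule filterlim_compose[rotated])
  have nrm: "norm (w k - z) * real (Suc k) \<le> 1 + V" for k
  proof -
    have "norm (w k - z) \<le> \<bar>d k\<bar> + \<bar>X (t - d k) y - X t y\<bar>"
      using norm_Pair_le[of "- d k" "X (t - d k) y - X t y"] by (simp add: w_def z_def)
    also have "\<dots> \<le> d k + V * d k" using X_lip_t_abs[of "t - d k" y t] d(2)[of k] by simp
    also have "\<dots> = (1 + V) * d k" by (simp add: algebra_simps)
    finally have "norm (w k - z) * real (Suc k) \<le> (1 + V) * d k * real (Suc k)"
      by (rule mult_right_mono) simp
    then show ?thesis by (simp add: d_def del: of_nat_Suc)
  qed
  have "(\<lambda>k. e k * (norm (w k - z) * real (Suc k))) \<longlonglongrightarrow> 0"
  proof (rule Lim_null_comparison)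
    show "\<forall>\<^sub>F k in sequentially. norm (e k * (norm (w k - z) * real (Suc k))) \<le> \<bar>e k\<bar> * (1 + V)"
      using nrm by (intro always_eventually allI) (simp add: abs_mult mult_left_mono)
    show "(\<lambda>k. \<bar>e k\<bar> * (1 + V)) \<longlonglongrightarrow> 0" using e0 by (auto intro!: tendsto_eq_intros)
  qed
  then have "(\<lambda>k. (a + (X t y - X (t - d k) y) * real (Suc k) * b) - e k * (norm (w k - z) * real (Suc k)))
      \<longlonglongrightarrow> (a + uL t y * b) - 0"
    using uL_lim[of t y] unfolding d_def by (intro tendsto_intros)
  also have "(\<lambda>k. (a + (X t y - X (t - d k) y) * real (Suc k) * b) - e k * (norm (w k - z) * real (Suc k)))
      = (\<lambda>k. (\<phi> z - \<phi> (w k)) * real (Suc k))"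
  proof
    fix k
    have "e k * norm (w k - z) = \<phi> (w k) - \<phi> z - D (w k - z)" using wz[of k] by (simp add: e_def)
    moreover have "D (w k - z) = - d k * a + (X (t - d k) y - X t y) * b" by (simp add: D_def w_def z_def)
    ultimately have *: "e k * norm (w k - z) = \<phi> (w k) - \<phi> z + d k * a - (X (t - d k) y - X t y) * b"
      by simp
    have "d k * real (Suc k) = 1" by (simp add: d_def del: of_nat_Suc)
    then show "(a + (X t y - X (t - d k) y) * real (Suc k) * b) - e k * (norm (w k - z) * real (Suc k))
      = (\<phi> z - \<phi> (w k)) * real (Suc k)"
      unfolding mult.assoc[symmetric] * by (simp add: algebra_simps del: of_nat_Suc)
  qed
  finally show ?thesis by (simp add: z_def w_def d_def)
qed

lemma integral_along_flow:
  assumes \<phi>: "\<phi> \<in> test_functions"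
    and der: "\<And>z. z \<in> half_plane \<Longrightarrow> (\<phi> has_derivative (\<lambda>(s, y). s * g z + y * k z)) (at z within half_plane)"
    and C: "\<And>z. \<bar>g z\<bar> \<le> C" "\<And>z. \<bar>k z\<bar> \<le> C"
    and R: "0 < R" "\<And>t x. 0 \<le> t \<Longrightarrow> R < t \<Longrightarrow> \<phi> (t, x) = 0"
  shows "(LINT t|lborel. indicator {0<..} t * (g (t, X t y) + uL t y * k (t, X t y))) = - \<phi> (0, y)"
proof -
  have "0 \<le> C" using C(1)[of "(0,0)"] by linarith
  have lip: "norm (\<phi> z - \<phi> w) \<le> (2 * C) * norm (z - w)" if "z \<in> half_plane" "w \<in> half_plane" for z w
  proof (rule differentiable_bound[OF _ der _ that])
    show "convex half_plane" unfolding half_plane_def by (intro convex_Times) auto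
    fix v :: "real \<times> real"
    show "onorm (\<lambda>(s, y). s * g v + y * k v) \<le> 2 * C"
    proof (rule onorm_le)
      fix u :: "real \<times> real"
      obtain s x where u: "u = (s, x)" by fastforce
      have "\<bar>s * g v + x * k v\<bar> \<le> \<bar>s\<bar> * \<bar>g v\<bar> + \<bar>x\<bar> * \<bar>k v\<bar>"
        by (metis abs_mult abs_triangle_ineq)
      also have "\<dots> \<le> norm u * C + norm u * C"
        using norm_fst_le[of s x] norm_snd_le[of x s] C \<open>0 \<le> C\<close>
        by (intro add_mono mult_mono) (auto simp: u)
      finally show "norm (case u of (s, y) \<Rightarrow> s * g v + y * k v) \<le> 2 * C * norm u" by (simp add: u mult_ac)
    qed
  qed
  have "(LINT t|lborel. indicator {0<..} t * (g (t, X t y) + uL t y * k (t, X t y))) = - \<phi> (0, X 0 y)"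
  \<comment> \<open>The factor 2 C bounds the gradient of \<phi> and 1 + V the speed of the curve in
    the plane. T is R + 1 because the vanishing of \<phi> is given for t > R, with strict
    inequality.\<close>
  proof (rule integral_left_derivative[where f="\<lambda>t. \<phi> (t, X t y)" and L="2 * C * (1 + V)" and T="R + 1"])
    fix s t :: real assume st: "0 \<le> s" "s \<le> t"
    have "\<bar>\<phi> (t, X t y) - \<phi> (s, X s y)\<bar> \<le> 2 * C * norm ((t, X t y) - (s, X s y))"
      using lip[of "(t, X t y)" "(s, X s y)"] st by (simp add: half_plane_def)
    also have "norm ((t, X t y) - (s, X s y)) \<le> \<bar>t - s\<bar> + \<bar>X t y - X s y\<bar>"
      using norm_Pair_le[of "t - s" "X t y - X s y"] by simp
    also have "\<dots> \<le> (1 + V) * (t - s)" using X_lip_t_abs[of t y s] st by (simp add: algebra_simps)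
    finally show "\<bar>\<phi> (t, X t y) - \<phi> (s, X s y)\<bar> \<le> 2 * C * (1 + V) * (t - s)"
      using \<open>0 \<le> C\<close> by (simp add: mult.assoc mult_left_mono)
  next
    fix t :: real assume "0 < t"
    define z where "z = (t, X t y)"
    have z: "z \<in> open_half_plane" using \<open>0 < t\<close> by (simp add: z_def open_half_plane_def)
    have op: "open open_half_plane" unfolding open_half_plane_def by (intro open_Times) auto
    have sub: "open_half_plane \<subseteq> half_plane" by (auto simp: open_half_plane_def half_plane_def)
    have "(\<phi> has_derivative (\<lambda>(s, y). s * g z + y * k z)) (at z)"
      using has_derivative_subset[OF der[OF subsetD[OF sub z]] sub] at_within_open[OF z op] by simp
    then show "(\<lambda>k. (\<phi> (t, X t y) - \<phi> (t - 1 / real (Suc k), X (t - 1 / real (Suc k)) y)) * real (Suc k))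
           \<longlonglongrightarrow> g (t, X t y) + uL t y * k (t, X t y)"
      unfolding z_def by (rule flow_derivative)
  qed (use R in auto)
  then show ?thesis by simp
qed

lemma lebesgue_lborel_integral:
  fixes f :: "real \<Rightarrow> real"
  assumes "f \<in> borel_measurable borel"
  shows "(LINT x|lebesgue. f x) = (LINT x|lborel. f x)"
  by (rule integral_completion) (use assms in simp)

text \<open>Passing to labels and exchanging the integrals turns the weak form into an integral in t
  along each trajectory, on which Q is the constant q y. The transport condition is asked where mass
  is present, the only place that the weight sees.\<close>

lemma weak_law:
  assumes Q [measurable]: "Q \<in> borel_measurable borel" and Q_bd: "\<And>z. \<bar>Q z\<bar> \<le> B"
    and q [measurable]: "q \<in> borel_measurable borel" and q_bd: "\<And>y. \<bar>q y\<bar> \<le> B"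
    and u [measurable]: "u \<in> borel_measurable borel" and u_bd: "\<And>z. \<bar>u z\<bar> \<le> V"
    and flow: "AE w in lborel. 0 < fst w \<and> 0 < h0 (snd w) \<longrightarrow>
        Q (flow w) = q (snd w) \<and> u (flow w) = uL (fst w) (snd w)"
    and \<rho>0 [measurable]: "\<rho>0 \<in> borel_measurable lebesgue" and \<rho>0_eq: "AE x in lebesgue. \<rho>0 x = h0 x * q x"
  shows "weak_conservation_law (\<lambda>z. h z * Q z) (\<lambda>z. h z * Q z * u z) \<rho>0"
  unfolding weak_conservation_law_def
proof
  fix \<phi> assume \<phi>: "\<phi> \<in> test_functions"
  obtain g k C R where g [measurable]: "g \<in> borel_measurable borel" and k [measurable]: "k \<in> borel_measurable borel"
    and C: "\<And>z. \<bar>g z\<bar> \<le> C" "\<And>z. \<bar>k z\<bar> \<le> C" and R: "0 < R"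
    "\<And>t x. R < \<bar>t\<bar> \<or> R < \<bar>x\<bar> \<Longrightarrow> g (t, x) = 0 \<and> k (t, x) = 0"
    "\<And>t x. 0 \<le> t \<Longrightarrow> R < t \<Longrightarrow> \<phi> (t, x) = 0"
    and der: "\<And>z. z \<in> half_plane \<Longrightarrow> (\<phi> has_derivative (\<lambda>(s, y). s * g z + y * k z)) (at z within half_plane)"
    by (rule test_function_derivatives[OF \<phi>]) blast
  have op: "open open_half_plane" unfolding open_half_plane_def by (intro open_Times) auto
  have sub: "open_half_plane \<subseteq> half_plane" by (auto simp: open_half_plane_def half_plane_def)
  have derivs: "deriv (\<lambda>s. \<phi> (s, x)) t = g (t, x)" "deriv (\<lambda>y. \<phi> (t, y)) x = k (t, x)" if "0 < t" for t x
  proof -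
    have z: "(t, x) \<in> open_half_plane" using that by (simp add: open_half_plane_def)
    have d: "(\<phi> has_derivative (\<lambda>(s, y). s * g (t, x) + y * k (t, x))) (at (t, x))"
      using has_derivative_subset[OF der[OF subsetD[OF sub z]] sub] at_within_open[OF z op] by simp
    have "((\<lambda>s. (s, x)) has_derivative (\<lambda>s. (s, 0))) (at t)" "((\<lambda>y. (t, y)) has_derivative (\<lambda>y. (0, y))) (at x)"
      by (auto intro!: derivative_eq_intros)
    from has_derivative_compose[OF this(1) d] has_derivative_compose[OF this(2) d]
    have "((\<lambda>s. \<phi> (s, x)) has_derivative (\<lambda>s. s * g (t, x))) (at t)"
      "((\<lambda>y. \<phi> (t, y)) has_derivative (\<lambda>y. y * k (t, x))) (at x)" by simp_all
    then show "deriv (\<lambda>s. \<phi> (s, x)) t = g (t, x)" "deriv (\<lambda>y. \<phi> (t, y)) x = k (t, x)"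
      by (auto intro!: DERIV_imp_deriv simp: has_field_derivative_def mult_commute_abs)
  qed
  define F where "F z = indicator {0<..} (fst z) * Q z * (g z + u z * k z)" for z
  have [measurable]: "fst \<in> borel_measurable (borel :: (real \<times> real) measure)" "snd \<in> borel_measurable (borel :: (real \<times> real) measure)"
    by (auto intro!: borel_measurable_continuous_onI continuous_intros)
  have F [measurable]: "F \<in> borel_measurable borel" unfolding F_def by measurable
  have B: "0 \<le> B" "0 \<le> C" using Q_bd[of "(0,0)"] C(1)[of "(0,0)"] by auto
  have F_bd: "\<bar>F z\<bar> \<le> B * (C + V * C)" for z
  proof -
    have "\<bar>g z + u z * k z\<bar> \<le> C + V * C"
      using C[of z] u_bd[of z] B V_nonneg by (intro order_trans[OF abs_triangle_ineq] add_mono) (auto simp: abs_mult intro!: mult_mono)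
    then have "\<bar>Q z\<bar> * \<bar>g z + u z * k z\<bar> \<le> B * (C + V * C)"
      using Q_bd[of z] B by (intro mult_mono) auto
    then show ?thesis using B V_nonneg by (auto simp: F_def abs_mult split: split_indicator)
  qed
  have F_out: "F z = 0" if "z \<notin> {0..R} \<times> {-R..R}" for z
  proof (cases "0 < fst z")
    case True
    then have "R < \<bar>fst z\<bar> \<or> R < \<bar>snd z\<bar>" using that by (cases z) auto
    then show ?thesis using R(2)[of "fst z" "snd z"] by (simp add: F_def)
  qed (simp add: F_def)
  \<comment> \<open>A bounded function supported in a box; its integrability justifies both uses of
    Fubini, in positions and in labels.\<close>
  have int_hF: "integrable lborel (\<lambda>z. h z * F z)"
  proof (rule integrableI_bounded_set[where A="{0..R} \<times> {-R..R}" and B="B * (C + V * C)"])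
    have box: "{0..R} \<times> {- R..R} \<in> sets borel" by (intro borel_closed closed_Times) auto
    then show "{0..R} \<times> {- R..R} \<in> sets (lborel :: (real \<times> real) measure)" by simp
    have "emeasure lborel ({0..R} \<times> {- R..R}) \<le> emeasure lborel (cbox (0, -R) (R, R))"
      by (rule emeasure_mono) (auto simp: cbox_Pair_eq box)
    then show "emeasure lborel ({0..R} \<times> {- R..R}) < \<infinity>"
      using emeasure_lborel_cbox_finite order_le_less_trans by blast
    have "\<bar>h z * F z\<bar> \<le> B * (C + V * C)" for z
      using mult_mono[OF h_le_1 F_bd, of z z] h_nonneg[of z] by (simp add: abs_mult)
    then show "AE z\<in>{0..R} \<times> {-R..R} in lborel. norm (h z * F z) \<le> B * (C + V * C)" by simp
  qed (use F_out in auto)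
  have int_w: "integrable (lborel \<Otimes>\<^sub>M lborel) (\<lambda>w. wt w * F (flow w))"
    using int_hF transport_integral(2)[OF F] by (simp add: lborel_prod)
  have meas: "(\<lambda>w. wt w * F (flow w)) \<in> borel_measurable (lborel \<Otimes>\<^sub>M lborel)"
      unfolding lborel_prod by measurable
  have meas': "(\<lambda>(t, y). indicator {0<..} t * h0 y * q y * (g (t, X t y) + uL t y * k (t, X t y))) \<in> borel_measurable (lborel \<Otimes>\<^sub>M lborel)"
      unfolding split_beta' by measurable
  have eq: "AE w in lborel \<Otimes>\<^sub>M lborel. wt w * F (flow w) = (case w of (t, y) \<Rightarrow> indicator {0<..} t * h0 y * q y * (g (t, X t y) + uL t y * k (t, X t y)))"
      using flow unfolding lborel_prod
    proof eventually_elim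
      case (elim w)
      obtain t y where w: "w = (t, y)" by fastforce
      show ?case
        using elim h0_nonneg[of y] by (cases "0 < t \<and> 0 < h0 y") (auto simp: w wt_def F_def flow_def)
    qed
  have "(LINT t:{0<..}|lebesgue. LINT x|lebesgue.
        h (t, x) * Q (t, x) * deriv (\<lambda>s. \<phi> (s, x)) t + h (t, x) * Q (t, x) * u (t, x) * deriv (\<lambda>y. \<phi> (t, y)) x)
      = (LINT t|lebesgue. LINT x|lborel. h (t, x) * F (t, x))"
    unfolding set_lebesgue_integral_def
  proof (rule Bochner_Integration.integral_cong[OF refl])
    fix t :: real
    have "(LINT x|lebesgue. h (t, x) * Q (t, x) * deriv (\<lambda>s. \<phi> (s, x)) t + h (t, x) * Q (t, x) * u (t, x) * deriv (\<lambda>y. \<phi> (t, y)) x)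
        = (LINT x|lebesgue. h (t, x) * F (t, x))" if "0 < t"
      using that by (intro Bochner_Integration.integral_cong[OF refl]) (simp add: derivs F_def algebra_simps)
    also have "\<dots> = (LINT x|lborel. h (t, x) * F (t, x))"
      by (rule lebesgue_lborel_integral) measurable
    finally show "indicator {0<..} t *\<^sub>R (LINT x|lebesgue. h (t, x) * Q (t, x) * deriv (\<lambda>s. \<phi> (s, x)) t + h (t, x) * Q (t, x) * u (t, x) * deriv (\<lambda>y. \<phi> (t, y)) x)
        = (LINT x|lborel. h (t, x) * F (t, x))"
      by (cases "0 < t") (auto simp: F_def)
  qed
  also have "\<dots> = (LINT t|lborel. LINT x|lborel. h (t, x) * F (t, x))"
  proof (rule lebesgue_lborel_integral)
    have "(\<lambda>(t, x). h (t, x) * F (t, x)) \<in> borel_measurable (borel \<Otimes>\<^sub>M lborel)"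
      by (simp add: borel_prod measurable_cong_sets[OF sets_pair_measure_cong[OF refl sets_lborel] refl] split_beta')
    then show "(\<lambda>t. LINT x|lborel. h (t, x) * F (t, x)) \<in> borel_measurable borel"
      by (rule lborel.borel_measurable_lebesgue_integral)
  qed
  also have "\<dots> = (LINT z|lborel. h z * F z)"
    using lborel_pair.integral_fst'[of "\<lambda>z. h z * F z"] int_hF by (simp add: lborel_prod)
  also have "\<dots> = (LINT w|(lborel \<Otimes>\<^sub>M lborel). wt w * F (flow w))"
    unfolding transport_integral(1)[OF F] lborel_prod ..
  also have "\<dots> = (LINT (t, y)|(lborel \<Otimes>\<^sub>M lborel). indicator {0<..} t * h0 y * q y * (g (t, X t y) + uL t y * k (t, X t y)))"
    by (rule integral_cong_AE[OF meas meas' eq])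
  also have "\<dots> = (LINT y|lborel. LINT t|lborel. indicator {0<..} t * h0 y * q y * (g (t, X t y) + uL t y * k (t, X t y)))"
  proof -
    have "integrable (lborel \<Otimes>\<^sub>M lborel)
        (\<lambda>(t, y). indicator {0<..} t * h0 y * q y * (g (t, X t y) + uL t y * k (t, X t y)))"
      using int_w integrable_cong_AE[OF meas meas' eq] by blast
    from lborel_pair.integral_snd[OF this] show ?thesis by (rule sym)
  qed
  also have "\<dots> = (LINT y|lborel. h0 y * q y * (- \<phi> (0, y)))"
  proof (rule Bochner_Integration.integral_cong[OF refl])
    fix y
    have "(LINT t|lborel. indicator {0<..} t * h0 y * q y * (g (t, X t y) + uL t y * k (t, X t y)))
      = (LINT t|lborel. h0 y * q y * (indicator {0<..} t * (g (t, X t y) + uL t y * k (t, X t y))))"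
      by (rule Bochner_Integration.integral_cong) auto
    also have "\<dots> = h0 y * q y * (- \<phi> (0, y))"
      using integral_along_flow[OF \<phi> der C R(1,3), of y] by simp
    finally show "(LINT t|lborel. indicator {0<..} t * h0 y * q y * (g (t, X t y) + uL t y * k (t, X t y))) = h0 y * q y * (- \<phi> (0, y))" .
  qed
  also have "\<dots> = - (LINT y|lebesgue. \<rho>0 y * \<phi> (0, y))"
  proof -
    have "continuous_on half_plane \<phi>"
      using \<phi> unfolding test_functions_def by (metis (no_types, lifting) Ck_half_plane.simps(1) mem_Collect_eq)
    then have "continuous_on UNIV (\<lambda>y. \<phi> (0, y))"
      by (rule continuous_on_compose2) (auto intro!: continuous_intros simp: half_plane_def)
    then have [measurable]: "(\<lambda>y. \<phi> (0, y)) \<in> borel_measurable borel"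
      by (rule borel_measurable_continuous_onI)
    have "(LINT y|lebesgue. \<rho>0 y * \<phi> (0, y)) = (LINT y|lebesgue. h0 y * q y * \<phi> (0, y))"
    proof (rule integral_cong_AE)
      show "AE y in lebesgue. \<rho>0 y * \<phi> (0, y) = h0 y * q y * \<phi> (0, y)"
        using \<rho>0_eq by eventually_elim simp
      have "(\<lambda>y. \<phi> (0, y)) \<in> borel_measurable lebesgue" by (rule measurable_completion) simp
      then show "(\<lambda>y. \<rho>0 y * \<phi> (0, y)) \<in> borel_measurable lebesgue"
        by (rule borel_measurable_times[OF \<rho>0])
      show "(\<lambda>y. h0 y * q y * \<phi> (0, y)) \<in> borel_measurable lebesgue"
        by (rule measurable_completion) simp
    qed
    also have "\<dots> = (LINT y|lborel. h0 y * q y * \<phi> (0, y))"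
      by (rule lebesgue_lborel_integral) measurable
    finally show ?thesis by simp
  qed
  finally show "(LINT t:{0<..}|lebesgue. LINT x|lebesgue.
        h (t, x) * Q (t, x) * deriv (\<lambda>s. \<phi> (s, x)) t + h (t, x) * Q (t, x) * u (t, x) * deriv (\<lambda>y. \<phi> (t, y)) x)
       + (LINT x|lebesgue. \<rho>0 x * \<phi> (0, x)) = 0" by simp
qed

end

subsection \<open>Eulerian velocity and pressure\<close>

lemma AE_snd_lborel:
  assumes "AE y in (lborel :: real measure). P y"
  shows "AE w in (lborel :: (real \<times> real) measure). P (snd w)"
proof -
  obtain N where N: "{y. \<not> P y} \<subseteq> N" "N \<in> null_sets (lborel :: real measure)"
    using assms unfolding eventually_ae_filter by auto
  have "UNIV \<times> N \<in> null_sets ((lborel :: real measure) \<Otimes>\<^sub>M (lborel :: real measure))"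
    using N(2) by (auto simp: null_sets_def lborel.emeasure_pair_measure_Times)
  then have "AE w in (lborel :: (real \<times> real) measure). w \<notin> UNIV \<times> N"
    unfolding lborel_prod by (rule AE_not_in)
  then show ?thesis by eventually_elim (use N(1) in auto)
qed

context follow_the_leader
begin

text \<open>If a label y' > y were at or behind \<open>X t y\<close>, non-overlap would leave no
  mass between y and y', and y would be dead.\<close>

lemma A_X: "\<not> dead y \<Longrightarrow> A t (X t y) = y"
proof (rule antisym)
  assume alive: "\<not> dead y"
  show "A t (X t y) \<le> y"
  proof (rule ccontr)
    assume "\<not> ?thesis"
    then obtain y' where y': "y < y'" "X t y' \<le> X t y" using less_A_iff[of y t "X t y"] by auto
    then have "G y' = G y" using X_diff[of y y' t] G_mono[of y y'] by simp
    then show False using alive y' by (auto simp: dead_def)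
  qed
qed (simp add: le_A)

text \<open>A car slower than desired is late, since contact with the free motion would give
  velocity v y. The constancy of \<open>Y t\<close> ahead of it becomes constancy of the gap between
  the positions of y and c.\<close>

lemma flat_ahead_of_blocked:
  assumes "right_lsc y" "0 < t" "\<not> dead y" "uL t y \<noteq> v y"
  shows "\<exists>c\<in>\<rat>. X t y < c \<and> gap t (X t y) = gap t c"
proof -
  have "X t y < y + v y * t" using uL_contact[of t y] X_le[of t y] assms by fastforce
  then obtain c where c: "y < c" "Y t c = Y t y" using blocked assms(1,2) by blast
  have "G y < G c" using assms(3) c(1) G_mono[of y c] by (force simp: dead_def)
  then have less: "X t y < X t c" using c(2) by (simp add: X_def)
  have "gap t (X t c) \<le> X t c - G c" using le_A[of t c "X t c"] G_mono by (simp add: gap_def)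
  also have "\<dots> = X t y - G y" using c(2) by (simp add: X_def)
  also have "\<dots> = gap t (X t y)" by (simp add: gap_def A_X assms(3))
  finally have le: "gap t (X t c) \<le> gap t (X t y)" .
  \<comment> \<open>\<open>h_flat\<close> speaks of rational right ends; monotonicity of the gap
    lets any rational point in between serve as one.\<close>
  obtain r where r: "r \<in> \<rat>" "X t y < r" "r < X t c" using Rats_dense_in_real[OF less] by auto
  then show ?thesis
    using le gap_mono[of "X t y" r t] gap_mono[of r "X t c" t] by (intro bexI[of _ r]) auto
qed

text \<open>The split on \<open>h z = 1\<close> lets the pressure vanish at every point where the
  road is not saturated, while u + p remains the desired velocity at the label everywhere. By
  \<open>u_flow\<close>, almost all cars still travel with their left derivative.\<close>

definition u :: "real \<times> real \<Rightarrow> real" where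
  "u z = (if h z = 1 then uL (fst z) (A (fst z) (snd z)) else v (A (fst z) (snd z)))"

definition p :: "real \<times> real \<Rightarrow> real" where
  "p z = (if h z = 1 then v (A (fst z) (snd z)) - uL (fst z) (A (fst z) (snd z)) else 0)"

lemma u_plus_p: "u z + p z = v (A (fst z) (snd z))"
  by (simp add: u_def p_def)

lemma u_bounds: "0 \<le> u z" "u z \<le> V"
  by (simp_all add: u_def uL_nonneg v_nonneg uL_le_V v_le)

lemma p_bounds: "0 < fst z \<Longrightarrow> 0 \<le> p z" "p z \<le> V"
  using uL_le_v[of "fst z" "A (fst z) (snd z)"] uL_nonneg[of "fst z" "A (fst z) (snd z)"]
    v_le[of "A (fst z) (snd z)"] V_nonneg
  by (auto simp: p_def)

lemma fst_meas [measurable]: "fst \<in> borel_measurable (borel :: (real \<times> real) measure)"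
  and snd_meas [measurable]: "snd \<in> borel_measurable (borel :: (real \<times> real) measure)"
  by (auto intro!: borel_measurable_continuous_onI continuous_intros)

lemma u_meas [measurable]: "u \<in> borel_measurable borel"
  unfolding u_def by measurable

lemma p_meas [measurable]: "p \<in> borel_measurable borel"
  unfolding p_def by measurable

text \<open>A car either has its desired velocity, where both branches of \<open>u\<close> agree, or
  is blocked, where \<open>h = 1\<close> selects the left derivative.\<close>

lemma u_flow:
  assumes "AE y in lborel. 0 < h0 y \<longrightarrow> right_lsc y"
  shows "AE w in lborel. 0 < fst w \<and> 0 < h0 (snd w) \<longrightarrow> u (flow w) = uL (fst w) (snd w)"
  using transport_AE[OF h_flat] AE_snd_lborel[OF AE_dead] AE_snd_lborel[OF assms]
proof eventually_elim
  case (elim w)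
  obtain t y where w: "w = (t, y)" by fastforce
  show ?case
  proof
    assume ty: "0 < fst w \<and> 0 < h0 (snd w)"
    then have "\<not> dead y" "right_lsc y" "0 < t" using elim by (auto simp: w)
    then have "uL t y = v y \<or> h (t, X t y) = 1"
      using flat_ahead_of_blocked[of y t] elim(1) ty by (auto simp: w flow_def)
    then show "u (flow w) = uL (fst w) (snd w)"
      using A_X[OF \<open>\<not> dead y\<close>] by (auto simp: w flow_def u_def)
  qed
qed

lemma A_flow: "AE w in lborel. 0 < fst w \<and> 0 < h0 (snd w) \<longrightarrow> A (fst (flow w)) (snd (flow w)) = snd w"
  using AE_snd_lborel[OF AE_dead] by eventually_elim (auto simp: flow_def A_X split: prod.split)

text \<open>The density is determined only up to a space-time null set, so a single time carries no
  information. The time marginal of \<mu>2 is computed in two ways instead, and uniqueness of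
  densities gives the identity for almost every t.\<close>

lemma h_section_mass:
  "AE t in lborel. (\<integral>\<^sup>+ x. ennreal (h (t, x)) \<partial>lborel) = emeasure \<rho> UNIV * indicator {0<..} t"
proof -
  have hp: "(\<lambda>z. ennreal (h z)) \<in> borel_measurable ((lborel :: real measure) \<Otimes>\<^sub>M (lborel :: real measure))"
    unfolding lborel_prod by measurable
  have m: "(\<lambda>t. \<integral>\<^sup>+ x. ennreal (h (t, x)) \<partial>lborel) \<in> borel_measurable lborel"
    using lborel.borel_measurable_nn_integral_fst[OF hp] by simp
  have "density lborel (\<lambda>t. \<integral>\<^sup>+ x. ennreal (h (t, x)) \<partial>lborel) = density lborel (\<lambda>t. emeasure \<rho> UNIV * indicator {0<..} t)"
  proof (rule measure_eqI)
    fix S assume "S \<in> sets (density lborel (\<lambda>t. \<integral>\<^sup>+ x. ennreal (h (t, x)) \<partial>lborel))"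
    then have S [measurable]: "S \<in> sets borel" by simp
    have S2: "S \<times> (UNIV :: real set) \<in> sets borel"
      using pair_measureI[of S borel "UNIV :: real set" borel] S unfolding borel_prod by simp
    have "emeasure (density lborel (\<lambda>t. \<integral>\<^sup>+ x. ennreal (h (t, x)) \<partial>lborel)) S
        = (\<integral>\<^sup>+ t. (\<integral>\<^sup>+ x. ennreal (h (t, x)) \<partial>lborel) * indicator S t \<partial>lborel)"
      using m by (simp add: emeasure_density)
    also have "\<dots> = (\<integral>\<^sup>+ t. (\<integral>\<^sup>+ x. ennreal (h (t, x)) * indicator (S \<times> UNIV) (t, x) \<partial>lborel) \<partial>lborel)"
      by (intro nn_integral_cong) (auto split: split_indicator)
    also have "\<dots> = (\<integral>\<^sup>+ z. ennreal (h z) * indicator (S \<times> UNIV) z \<partial>lborel)"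
      using lborel.nn_integral_fst[of "\<lambda>z. ennreal (h z) * indicator (S \<times> UNIV) z" "lborel :: real measure"] S2
      by (simp add: lborel_prod)
    also have "\<dots> = emeasure \<mu>2 (S \<times> UNIV)" using S2 by (simp add: \<mu>2_eq emeasure_density)
    also have "\<dots> = (\<integral>\<^sup>+ t. indicator {0<..} t * emeasure (\<mu>1 t) (Pair t -` (S \<times> UNIV)) \<partial>lborel)"
      by (rule emeasure_\<mu>2[OF S2])
    also have "\<dots> = (\<integral>\<^sup>+ t. emeasure \<rho> UNIV * indicator {0<..} t * indicator S t \<partial>lborel)"
      by (intro nn_integral_cong) (auto simp: \<mu>1_def emeasure_distr split: split_indicator)
    also have "\<dots> = emeasure (density lborel (\<lambda>t. emeasure \<rho> UNIV * indicator {0<..} t)) S"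
      by (simp add: emeasure_density)
    finally show "emeasure (density lborel (\<lambda>t. \<integral>\<^sup>+ x. ennreal (h (t, x)) \<partial>lborel)) S
        = emeasure (density lborel (\<lambda>t. emeasure \<rho> UNIV * indicator {0<..} t)) S" .
  qed simp
  then show ?thesis
    using m by (subst (asm) sigma_finite_measure.density_unique_iff[OF sigma_finite_lborel]) auto
qed

lemma h_section_integrable:
  "AE t in lborel. integrable lborel (\<lambda>x. h (t, x)) \<and> (LINT x|lborel. h (t, x)) \<le> measure \<rho> UNIV"
  using h_section_mass
proof eventually_elim
  case (elim t)
  have [measurable]: "(\<lambda>x. h (t, x)) \<in> borel_measurable borel" by measurable
  have fin: "(\<integral>\<^sup>+ x. ennreal (h (t, x)) \<partial>lborel) \<le> ennreal (measure \<rho> UNIV)"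
    unfolding elim by (simp add: \<rho>.emeasure_eq_measure split: split_indicator)
  then have "integrable lborel (\<lambda>x. h (t, x))"
    by (intro integrableI_bounded) (auto simp: h_nonneg intro: order_le_less_trans)
  moreover have "(LINT x|lborel. h (t, x)) \<le> measure \<rho> UNIV"
    using fin by (subst integral_eq_nn_integral) (auto simp: h_nonneg intro: enn2real_leI)
  ultimately show ?case ..
qed

end

subsection \<open>Functions of bounded variation\<close>

text \<open>The average of \<phi> over [x, x + e] is an admissible test function of class C1 whose
  derivative is a difference quotient of \<phi>; a translation then moves the difference onto
  f.\<close>

lemma test_difference_quotient:
  fixes f \<phi> :: "real \<Rightarrow> real"
  assumes f [measurable]: "f \<in> borel_measurable borel" and K: "\<And>x. \<bar>f x\<bar> \<le> K"
    and test: "\<And>\<phi>. \<phi> C1_differentiable_on UNIV \<Longrightarrow> compact (closure {x. \<phi> x \<noteq> 0}) \<Longrightarrow>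
                (\<And>x. \<bar>\<phi> x\<bar> \<le> 1) \<Longrightarrow> (LINT x|lborel. f x * deriv \<phi> x) \<le> C"
    and \<phi>: "continuous_on UNIV \<phi>" "\<And>x. \<bar>\<phi> x\<bar> \<le> 1" "\<And>x. R < \<bar>x\<bar> \<Longrightarrow> \<phi> x = 0"
    and e: "0 < e"
  shows "(LINT x|lborel. \<phi> x * (f (x - e) - f x)) \<le> C * e"
proof -
  obtain P where P: "\<And>x. (P has_real_derivative \<phi> x) (at x)"
    using einterval_antiderivative[of "-\<infinity>" \<infinity> \<phi>] \<phi>(1)
    by (auto simp: continuous_on_eq_continuous_at has_real_derivative_iff_has_vector_derivative)
  define \<Phi> where "\<Phi> x = (P (x + e) - P x) / e" for x
  \<comment> \<open>The mean value theorem yields both the bound by 1 and the compact support of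
    \<Phi>.\<close>
  have mv: "\<exists>z. x < z \<and> z < x + e \<and> \<Phi> x = \<phi> z" for x
  proof -
    have "\<exists>z. x < z \<and> z < x + e \<and> P (x + e) - P x = (x + e - x) * \<phi> z"
      using e P by (intro MVT2) auto
    then show ?thesis using e by (auto simp: \<Phi>_def)
  qed
  have \<Phi>_der: "(\<Phi> has_real_derivative (\<phi> (x + e) - \<phi> x) / e) (at x)" for x
  proof -
    have "((\<lambda>x. P (x + e)) has_real_derivative \<phi> (x + e)) (at x)"
      by (rule DERIV_shift[THEN iffD1, OF P])
    then show ?thesis unfolding \<Phi>_def using P e by (auto intro!: derivative_eq_intros)
  qed
  have "(LINT x|lborel. f x * deriv \<Phi> x) \<le> C"
  proof (rule test)
    show "\<Phi> C1_differentiable_on UNIV"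
      unfolding C1_differentiable_on_def
    proof (intro exI[of _ "\<lambda>x. (\<phi> (x + e) - \<phi> x) / e"] conjI ballI)
      show "(\<Phi> has_vector_derivative (\<phi> (x + e) - \<phi> x) / e) (at x)" for x
        using \<Phi>_der by (simp add: has_real_derivative_iff_has_vector_derivative)
      show "continuous_on UNIV (\<lambda>x. (\<phi> (x + e) - \<phi> x) / e)"
        using e by (intro continuous_intros continuous_on_compose2[OF \<phi>(1)]) auto
    qed
    have "{x. \<Phi> x \<noteq> 0} \<subseteq> {- (R + e)..R + e}"
    proof
      fix x assume "x \<in> {x. \<Phi> x \<noteq> 0}"
      then obtain z where "x < z" "z < x + e" "\<phi> z \<noteq> 0" using mv[of x] by auto
      then show "x \<in> {- (R + e)..R + e}" using \<phi>(3)[of z] e by fastforce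
    qed
    then show "compact (closure {x. \<Phi> x \<noteq> 0})"
      by (meson bounded_closed_interval bounded_subset compact_closure)
    show "\<bar>\<Phi> x\<bar> \<le> 1" for x using mv[of x] \<phi>(2) by auto
  qed
  also have "(\<lambda>x. f x * deriv \<Phi> x) = (\<lambda>x. (f x * \<phi> (x + e) - f x * \<phi> x) / e)"
    by (simp add: DERIV_imp_deriv[OF \<Phi>_der] algebra_simps)
  finally have le: "(LINT x|lborel. f x * \<phi> (x + e) - f x * \<phi> x) \<le> C * e"
    using e by (simp add: field_simps)
  have [measurable]: "\<phi> \<in> borel_measurable borel" by (rule borel_measurable_continuous_onI[OF \<phi>(1)])
  have int: "integrable lborel (\<lambda>x. f (x - d) * \<phi> x)" for d
  proof (rule integrableI_bounded_set[where A="{-R..R}" and B=K])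
    have "\<bar>f (x - d) * \<phi> x\<bar> \<le> K" for x
      using mult_mono[OF K[of "x - d"] \<phi>(2)[of x]] K[of 0] by (auto simp: abs_mult)
    then show "AE x\<in>{-R..R} in lborel. norm (f (x - d) * \<phi> x) \<le> K" by simp
    show "AE x in lborel. x \<notin> {-R..R} \<longrightarrow> f (x - d) * \<phi> x = 0"
      using \<phi>(3) by (intro AE_I2) fastforce
  qed (auto simp: emeasure_lborel_Icc_eq)
  have shift: "integrable lborel (\<lambda>x. f x * \<phi> (x + e))"
    "(LINT x|lborel. f x * \<phi> (x + e)) = (LINT x|lborel. f (x - e) * \<phi> x)"
    using lborel_integrable_real_affine[OF int[of e], of 1 e]
      lborel_integral_real_affine[of 1 "\<lambda>x. f (x - e) * \<phi> x" e] by (auto simp: add.commute)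
  have "(LINT x|lborel. \<phi> x * (f (x - e) - f x)) = (LINT x|lborel. f (x - e) * \<phi> x - f x * \<phi> x)"
    by (simp add: algebra_simps)
  also have "\<dots> = (LINT x|lborel. f x * \<phi> (x + e) - f x * \<phi> x)"
    using int[of e] int[of 0] shift by simp
  finally show ?thesis using le by simp
qed

text \<open>A measurable function is almost everywhere a limit of continuous ones; truncating these
  to [-1, 1] and multiplying by a cutoff equal to 1 on [-R, R] preserves the limit.\<close>

lemma continuous_approx_bounded:
  fixes s :: "real \<Rightarrow> real"
  assumes [measurable]: "s \<in> borel_measurable borel" and s: "\<And>x. \<bar>s x\<bar> \<le> 1" "\<And>x. R < \<bar>x\<bar> \<Longrightarrow> s x = 0"
  obtains \<phi> :: "nat \<Rightarrow> real \<Rightarrow> real" where "\<And>n. continuous_on UNIV (\<phi> n)" "\<And>n x. \<bar>\<phi> n x\<bar> \<le> 1"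
    "\<And>n x. R + 1 < \<bar>x\<bar> \<Longrightarrow> \<phi> n x = 0" "AE x in lborel. (\<lambda>n. \<phi> n x) \<longlonglongrightarrow> s x"
proof -
  have "s \<in> borel_measurable lebesgue" by (rule measurable_completion) simp
  then have "s measurable_on UNIV" by (rule lebesgue_measurable_imp_measurable_on) simp
  then obtain N g where N: "negligible N" and g: "\<And>n. continuous_on UNIV (g n)" "\<And>x. x \<notin> N \<Longrightarrow> (\<lambda>n. g n x) \<longlonglongrightarrow> s x"
    unfolding measurable_on_def by auto
  define cut where "cut x = max 0 (min 1 (R + 1 - \<bar>x\<bar>))" for x
  define \<phi> where "\<phi> n x = max (-1) (min 1 (g n x)) * cut x" for n x
  show thesis
  proof
    show "continuous_on UNIV (\<phi> n)" for n unfolding \<phi>_def cut_def by (intro continuous_intros g)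
    show "\<bar>\<phi> n x\<bar> \<le> 1" for n x
    proof -
      have "\<bar>max (-1) (min 1 (g n x))\<bar> * \<bar>cut x\<bar> \<le> 1 * 1" by (intro mult_mono) (auto simp: cut_def)
      then show ?thesis by (simp add: \<phi>_def abs_mult)
    qed
    show "\<phi> n x = 0" if "R + 1 < \<bar>x\<bar>" for n x using that by (auto simp: \<phi>_def cut_def)
    have "AE x in lebesgue. x \<notin> N" using N by (intro AE_not_in) (simp add: negligible_iff_null_sets)
    then have "AE x in lborel. x \<notin> N" by (simp add: AE_completion_iff)
    then show "AE x in lborel. (\<lambda>n. \<phi> n x) \<longlonglongrightarrow> s x"
    proof eventually_elim
      case (elim x)
      have "(\<lambda>n. \<phi> n x) \<longlonglongrightarrow> max (-1) (min 1 (s x)) * cut x"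
        unfolding \<phi>_def by (intro tendsto_intros g elim)
      moreover have "max (-1) (min 1 (s x)) * cut x = s x"
        using s(1)[of x] s(2)[of x] by (cases "R < \<bar>x\<bar>") (auto simp: cut_def)
      ultimately show ?case by simp
    qed
  qed
qed

text \<open>Duality: the sign of the difference, restricted to [-n, n] and approximated by
  continuous functions, serves as test function; monotone convergence in n removes the
  restriction.\<close>

lemma bv_translation:
  fixes f :: "real \<Rightarrow> real"
  assumes f [measurable]: "f \<in> borel_measurable borel" and K: "\<And>x. \<bar>f x\<bar> \<le> K"
    and test: "\<And>\<phi>. \<phi> C1_differentiable_on UNIV \<Longrightarrow> compact (closure {x. \<phi> x \<noteq> 0}) \<Longrightarrow>
                (\<And>x. \<bar>\<phi> x\<bar> \<le> 1) \<Longrightarrow> (LINT x|lborel. f x * deriv \<phi> x) \<le> C"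
    and e: "0 < e"
  shows "(\<integral>\<^sup>+ x. ennreal \<bar>f x - f (x - e)\<bar> \<partial>lborel) \<le> ennreal (C * e)"
proof -
  define D where "D x = f (x - e) - f x" for x
  have [measurable]: "D \<in> borel_measurable borel" unfolding D_def by measurable
  have DK: "\<bar>D x\<bar> \<le> 2 * K" for x using K[of x] K[of "x - e"] by (simp add: D_def)
  have bound: "(\<integral>\<^sup>+ x. ennreal \<bar>D x\<bar> * indicator {- real n..real n} x \<partial>lborel) \<le> ennreal (C * e)" for n
  proof -
    define s where "s x = sgn (D x) * indicator {- real n..real n} x" for x
    have [measurable]: "s \<in> borel_measurable borel" unfolding s_def by measurable
    obtain \<phi> :: "nat \<Rightarrow> real \<Rightarrow> real" where \<phi>: "\<And>n. continuous_on UNIV (\<phi> n)" "\<And>n x. \<bar>\<phi> n x\<bar> \<le> 1"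
      "\<And>k x. real n + 1 < \<bar>x\<bar> \<Longrightarrow> \<phi> k x = 0" "AE x in lborel. (\<lambda>n. \<phi> n x) \<longlonglongrightarrow> s x"
      by (rule continuous_approx_bounded[of s "real n"])
         (auto simp: s_def abs_mult abs_sgn_eq split: split_indicator)
    have [measurable]: "\<phi> k \<in> borel_measurable borel" for k by (rule borel_measurable_continuous_onI[OF \<phi>(1)])
    have lim: "(\<lambda>k. LINT x|lborel. \<phi> k x * D x) \<longlonglongrightarrow> (LINT x|lborel. s x * D x)"
    proof (rule integral_dominated_convergence[where w="\<lambda>x. 2 * K * indicator {- (real n + 1)..real n + 1} x"])
      show "AE x in lborel. (\<lambda>k. \<phi> k x * D x) \<longlonglongrightarrow> s x * D x"
        using \<phi>(4) by eventually_elim (intro tendsto_intros)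
      have "\<bar>\<phi> k x * D x\<bar> \<le> 2 * K * indicator {- (real n + 1)..real n + 1} x" for k x
      proof (cases "\<bar>x\<bar> \<le> real n + 1")
        case True
        have "\<bar>\<phi> k x\<bar> * \<bar>D x\<bar> \<le> 1 * (2 * K)" using \<phi>(2) DK by (intro mult_mono) auto
        moreover have "x \<in> {- (real n + 1)..real n + 1}" using True by (simp add: abs_le_iff)
        ultimately show ?thesis by (simp only: abs_mult indicator_simps)
      next
        case False
        then show ?thesis using \<phi>(3)[of x k] order_trans[OF abs_ge_zero K[of 0]] by simp
      qed
      then show "AE x in lborel. norm (\<phi> k x * D x) \<le> 2 * K * indicator {- (real n + 1)..real n + 1} x" for k
        by simp
    qed (auto simp: emeasure_lborel_Icc_eq)
    have "(LINT x|lborel. s x * D x) \<le> C * e"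
    proof (rule LIMSEQ_le_const2[OF lim], intro exI allI impI)
      fix k
      show "(LINT x|lborel. \<phi> k x * D x) \<le> C * e"
        unfolding D_def
        by (rule test_difference_quotient[OF f K test \<phi>(1,2) _ e, where R="real n + 1"]) (auto intro: \<phi>(3))
    qed
    moreover have sD: "s x * D x = \<bar>D x\<bar> * indicator {- real n..real n} x" for x
      by (simp add: s_def abs_sgn mult_ac)
    moreover have "integrable lborel (\<lambda>x. \<bar>D x\<bar> * indicator {- real n..real n} x)"
      by (rule integrableI_bounded_set[where A="{- real n..real n}" and B="2 * K"])
         (auto simp: emeasure_lborel_Icc_eq DK)
    ultimately have "(\<integral>\<^sup>+ x. ennreal (\<bar>D x\<bar> * indicator {- real n..real n} x) \<partial>lborel) \<le> ennreal (C * e)"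
      by (subst nn_integral_eq_integral) (auto intro!: ennreal_leI)
    then show ?thesis by (simp add: ennreal_mult ennreal_indicator)
  qed
  have "(\<integral>\<^sup>+ x. ennreal \<bar>f x - f (x - e)\<bar> \<partial>lborel)
      = (\<integral>\<^sup>+ x. (SUP n. ennreal \<bar>D x\<bar> * indicator {- real n..real n} x) \<partial>lborel)"
  proof (rule nn_integral_cong)
    fix x
    obtain n where "\<bar>x\<bar> \<le> real n" using real_arch_simple by blast
    then have "ennreal \<bar>D x\<bar> \<le> (SUP n. ennreal \<bar>D x\<bar> * indicator {- real n..real n} x)"
      by (intro SUP_upper2[of n]) (auto simp: abs_le_iff split: split_indicator)
    moreover have "(SUP n. ennreal \<bar>D x\<bar> * indicator {- real n..real n} x) \<le> ennreal \<bar>D x\<bar>"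
      by (intro SUP_least) (auto split: split_indicator)
    ultimately show "ennreal \<bar>f x - f (x - e)\<bar> = (SUP n. ennreal \<bar>D x\<bar> * indicator {- real n..real n} x)"
      by (simp add: D_def abs_minus_commute)
  qed
  also have "\<dots> = (SUP n. \<integral>\<^sup>+ x. ennreal \<bar>D x\<bar> * indicator {- real n..real n} x \<partial>lborel)"
    by (rule nn_integral_monotone_convergence_SUP) (auto simp: incseq_def le_fun_def split: split_indicator)
  also have "\<dots> \<le> ennreal (C * e)" by (rule SUP_least) (rule bound)
  finally show ?thesis .
qed

text \<open>The L1 distance between f and its average over a step \<open>d k\<close> is at most
  \<open>C * d k\<close>. Along geometric steps these errors are summable, so their sum is finite at
  almost every x and the averages converge there.\<close>

lemma bv_averages_converge:
  fixes f :: "real \<Rightarrow> real"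
  assumes f [measurable]: "f \<in> borel_measurable borel" and K: "\<And>x. \<bar>f x\<bar> \<le> K"
    and C: "0 \<le> C" "\<And>e. 0 < e \<Longrightarrow> (\<integral>\<^sup>+ x. ennreal \<bar>f x - f (x - e)\<bar> \<partial>lborel) \<le> ennreal (C * e)"
    and d: "\<And>k. d k = (1 / 2) ^ k"
  shows "AE x in lborel. (\<lambda>k. (LINT s|lborel. f s * indicator {x - d k<..x} s) / d k) \<longlonglongrightarrow> f x"
proof -
  have d_pos: "0 < d k" for k by (simp add: d)
  define a where "a k x = (LINT s|lborel. f s * indicator {x - d k<..x} s) / d k" for k x
  \<comment> \<open>Mean oscillation after rescaling the window to [0, 1]. As an extended
    nonnegative integral it admits Tonelli without integrability checks.\<close>
  define b where "b k x = (\<integral>\<^sup>+ w. ennreal \<bar>f (x - d k * w) - f x\<bar> * indicator {0..1} w \<partial>lborel)" for k x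
  have b_meas [measurable]: "b k \<in> borel_measurable borel" for k unfolding b_def by measurable
  have ab: "ennreal \<bar>a k x - f x\<bar> \<le> b k x" for k x
  proof -
    have "(LINT s|lborel. f s * indicator {x - d k<..x} s)
        = d k * (LINT w|lborel. f (x - d k * w) * indicator {x - d k<..x} (x - d k * w))"
      using lborel_integral_real_affine[of "- d k" "\<lambda>s. f s * indicator {x - d k<..x} s" x] d_pos[of k] by simp
    also have "(\<lambda>w. f (x - d k * w) * indicator {x - d k<..x} (x - d k * w)) = (\<lambda>w. f (x - d k * w) * indicator {0..<1} w)"
      using d_pos[of k] by (auto simp: fun_eq_iff zero_le_mult_iff split: split_indicator)
    finally have a_eq: "a k x = (LINT w|lborel. f (x - d k * w) * indicator {0..<1} w)"
      using d_pos[of k] by (simp add: a_def)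
    have int: "integrable lborel (\<lambda>w. g w * indicator {0..<1::real} w)"
      if [measurable]: "g \<in> borel_measurable borel" and "\<And>w. \<bar>g w\<bar> \<le> K" for g
      by (rule integrableI_bounded_set[where A="{0..<1}" and B=K]) (auto simp: that)
    have "a k x - f x = (LINT w|lborel. f (x - d k * w) * indicator {0..<1} w - f x * indicator {0..<1} w)"
      using int[of "\<lambda>w. f (x - d k * w)"] int[of "\<lambda>w. f x"] K by (simp add: a_eq)
    also have "(\<lambda>w. f (x - d k * w) * indicator {0..<1} w - f x * indicator {0..<1} w)
        = (\<lambda>w. (f (x - d k * w) - f x) * indicator {0..<1} w)" by (simp add: algebra_simps)
    finally have "ennreal \<bar>a k x - f x\<bar> \<le> (\<integral>\<^sup>+ w. ennreal \<bar>(f (x - d k * w) - f x) * indicator {0..<1} w\<bar> \<partial>lborel)"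
      using integral_norm_bound_ennreal[of lborel "\<lambda>w. (f (x - d k * w) - f x) * indicator {0..<1} w"]
        int[of "\<lambda>w. f (x - d k * w)"] int[of "\<lambda>w. f x"] K
      by (simp add: left_diff_distrib)
    also have "\<dots> \<le> b k x" unfolding b_def
      by (intro nn_integral_mono) (auto split: split_indicator)
    finally show ?thesis .
  qed
  have "(\<integral>\<^sup>+ x. b k x \<partial>lborel) \<le> ennreal (C * d k)" for k
  proof -
    have "(\<integral>\<^sup>+ x. b k x \<partial>lborel)
        = (\<integral>\<^sup>+ w. \<integral>\<^sup>+ x. ennreal \<bar>f (x - d k * w) - f x\<bar> * indicator {0..1} w \<partial>lborel \<partial>lborel)"
      unfolding b_def by (rule lborel_pair.Fubini') measurable
    also have "\<dots> \<le> (\<integral>\<^sup>+ w. ennreal (C * d k) * indicator {0..1::real} w \<partial>lborel)"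
    proof (rule nn_integral_mono)
      fix w :: real
      have "(\<integral>\<^sup>+ x. ennreal \<bar>f x - f (x - d k * w)\<bar> \<partial>lborel) \<le> ennreal (C * d k)" if "0 \<le> w" "w \<le> 1"
      proof (cases "w = 0")
        case False
        then have "(\<integral>\<^sup>+ x. ennreal \<bar>f x - f (x - d k * w)\<bar> \<partial>lborel) \<le> ennreal (C * (d k * w))"
          using that d_pos[of k] by (intro C) simp
        also have "\<dots> \<le> ennreal (C * d k)"
          using that d_pos[of k] C(1) by (intro ennreal_leI mult_left_mono) (auto simp: mult_left_le)
        finally show ?thesis .
      qed simp
      then show "(\<integral>\<^sup>+ x. ennreal \<bar>f (x - d k * w) - f x\<bar> * indicator {0..1} w \<partial>lborel) \<le> ennreal (C * d k) * indicator {0..1} w"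
        by (auto simp: abs_minus_commute split: split_indicator)
    qed
    also have "\<dots> = ennreal (C * d k)" by (simp add: nn_integral_cmult_indicator)
    finally show ?thesis .
  qed
  then have "(\<integral>\<^sup>+ x. (\<Sum>k. b k x) \<partial>lborel) \<le> (\<Sum>k. ennreal (C * d k))"
    by (subst nn_integral_suminf) (auto intro!: suminf_le summableI)
  also have "\<dots> < \<infinity>"
  proof -
    have "summable (\<lambda>k. C * d k)" unfolding d by (intro summable_mult summable_geometric) simp
    then show ?thesis using C(1) d_pos by (subst suminf_ennreal2) (auto intro: mult_nonneg_nonneg less_imp_le)
  qed
  finally have "AE x in lborel. (\<Sum>k. b k x) \<noteq> \<infinity>"
    by (intro nn_integral_noteq_infinite) auto
  then have "AE x in lborel. (\<lambda>k. a k x) \<longlonglongrightarrow> f x"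
  proof eventually_elim
    case (elim x)
    have "(\<Sum>k. ennreal \<bar>a k x - f x\<bar>) \<le> (\<Sum>k. b k x)" by (intro suminf_le summableI ab)
    then have "(\<Sum>k. ennreal \<bar>a k x - f x\<bar>) \<noteq> \<infinity>" using elim by (auto simp: top_unique)
    then have "summable (\<lambda>k. \<bar>a k x - f x\<bar>)" by (intro summable_suminf_not_top) auto
    then have "(\<lambda>k. \<bar>a k x - f x\<bar>) \<longlonglongrightarrow> 0" by (rule summable_LIMSEQ_zero)
    then have "(\<lambda>k. a k x - f x) \<longlonglongrightarrow> 0" by (rule tendsto_rabs_zero_cancel)
    then show ?case by (rule LIM_zero_cancel)
  qed
  then show ?thesis by (simp add: a_def)
qed

text \<open>F is a limit of variation functions of the averages of f. These are nondecreasing and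
  uniformly bounded, so Helly's theorem applies. Where F is continuous and the averages converge,
  the increments of F control those of f.\<close>

lemma bv_continuous_on_conull_set:
  fixes f :: "real \<Rightarrow> real"
  assumes f [measurable]: "f \<in> borel_measurable borel" and K: "\<And>x. \<bar>f x\<bar> \<le> K"
    and C: "0 \<le> C" "\<And>e. 0 < e \<Longrightarrow> (\<integral>\<^sup>+ x. ennreal \<bar>f x - f (x - e)\<bar> \<partial>lborel) \<le> ennreal (C * e)"
  obtains E F where "AE x in lborel. x \<in> E" "\<And>x. x \<in> E \<Longrightarrow> isCont F x"
    "\<And>x y. x \<in> E \<Longrightarrow> y \<in> E \<Longrightarrow> x \<le> y \<Longrightarrow> \<bar>f y - f x\<bar> \<le> F y - (F x :: real)"
proof -
  define d :: "nat \<Rightarrow> real" where "d k = (1 / 2) ^ k" for k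
  have d_pos: "0 < d k" for k by (simp add: d_def)
  define a where "a k x = (LINT s|lborel. f s * indicator {x - d k<..x} s) / d k" for k x
  have K_nonneg: "0 \<le> K" using order_trans[OF abs_ge_zero K[of 0]] .
  define D where "D k x = f x - f (x - d k)" for k x
  have [measurable]: "D k \<in> borel_measurable borel" for k unfolding D_def by measurable
  have D_fin: "(\<integral>\<^sup>+ x. ennreal \<bar>D k x\<bar> \<partial>lborel) \<le> ennreal (C * d k)" for k
    unfolding D_def by (rule C(2)[OF d_pos])
  have D_int: "integrable lborel (\<lambda>x. \<bar>D k x\<bar>)" for k
    using D_fin[of k] by (intro integrableI_bounded) (auto intro: order_le_less_trans)
  have D_int': "integrable lborel (\<lambda>s. \<bar>D k s\<bar> * indicator S s)" if "S \<in> sets borel" for k S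
    using integrable_mult_indicator[OF _ D_int, of S k] that by (simp add: mult.commute)
  have D_le: "(LINT x|lborel. \<bar>D k x\<bar>) \<le> C * d k" for k
    using D_fin[of k] C(1) d_pos[of k]
    by (subst integral_eq_nn_integral) (auto intro: enn2real_leI simp: mult_nonneg_nonneg less_imp_le)
  \<comment> \<open>The average \<open>a k\<close> has derivative \<open>D k x / d k\<close> almost
    everywhere, so W is its variation up to x; the translation estimate bounds it by C independently
    of k.\<close>
  define W where "W k x = (LINT s|lborel. \<bar>D k s\<bar> * indicator {..x} s) / d k" for k x
  have W_diff: "W k y - W k x = (LINT s|lborel. \<bar>D k s\<bar> * indicator {x<..y} s) / d k" if "x \<le> y" for k x y
  proof -
    have "(LINT s|lborel. \<bar>D k s\<bar> * indicator {..y} s) - (LINT s|lborel. \<bar>D k s\<bar> * indicator {..x} s)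
        = (LINT s|lborel. \<bar>D k s\<bar> * indicator {..y} s - \<bar>D k s\<bar> * indicator {..x} s)"
      by (rule Bochner_Integration.integral_diff[symmetric]) (auto intro: D_int')
    also have "\<dots> = (LINT s|lborel. \<bar>D k s\<bar> * indicator {x<..y} s)"
      using that by (intro Bochner_Integration.integral_cong) (auto split: split_indicator)
    finally show ?thesis by (simp add: W_def flip: diff_divide_distrib)
  qed
  have W_mono: "W k x \<le> W k y" if "x \<le> y" for k x y
  proof -
    have "0 \<le> (LINT s|lborel. \<bar>D k s\<bar> * indicator {x<..y} s) / d k"
      using d_pos[of k] by (intro divide_nonneg_pos integral_nonneg_AE) auto
    then show ?thesis using W_diff[OF that, of k] by linarith
  qed
  have W_lip: "W k y - W k x \<le> 2 * K / d k * (y - x)" if "x \<le> y" for k x y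
  proof -
    have "(LINT s|lborel. \<bar>D k s\<bar> * indicator {x<..y} s) \<le> (LINT s|lborel. 2 * K * indicator {x<..y} s)"
    proof (rule integral_mono)
      fix s
      have "\<bar>D k s\<bar> \<le> 2 * K" using K[of s] K[of "s - d k"] by (simp add: D_def)
      then show "\<bar>D k s\<bar> * indicator {x<..y} s \<le> 2 * K * indicator {x<..y} s"
        by (auto split: split_indicator)
    qed (use that in \<open>auto intro: D_int'\<close>)
    also have "\<dots> = 2 * K * (y - x)" using that by simp
    finally show ?thesis unfolding W_diff[OF that] using d_pos[of k] by (simp add: divide_right_mono)
  qed
  have W_bd: "\<bar>W k x\<bar> \<le> C" for k x
  proof -
    have "(LINT s|lborel. \<bar>D k s\<bar> * indicator {..x} s) \<le> (LINT s|lborel. \<bar>D k s\<bar>)"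
      by (rule integral_mono) (auto intro: D_int D_int' split: split_indicator)
    also have "\<dots> \<le> C * d k" by (rule D_le)
    finally have "W k x \<le> C" using d_pos[of k] by (simp add: W_def field_simps)
    moreover have "0 \<le> W k x" using d_pos[of k] by (simp add: W_def integral_nonneg_AE)
    ultimately show ?thesis by simp
  qed
  have a_W: "\<bar>a k y - a k x\<bar> \<le> W k y - W k x" if "x \<le> y" for k x y
  proof -
    have int: "integrable lborel (\<lambda>s. g s * indicator {l<..r} s)"
      if [measurable]: "g \<in> borel_measurable borel" and "\<And>s. \<bar>g s\<bar> \<le> K" for g and l r :: real
      by (rule integrableI_bounded_set[where A="{l..r}" and B=K])
         (auto simp: that emeasure_lborel_Icc_eq K_nonneg split: split_indicator)
    have shift: "(LINT s|lborel. f s * indicator {x - d k<..y - d k} s)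
        = (LINT s|lborel. f (s - d k) * indicator {x<..y} s)"
      using lborel_integral_real_affine[of 1 "\<lambda>s. f s * indicator {x - d k<..y - d k} s" "- d k"]
      by (simp add: indicator_def)
    have "d k * (a k y - a k x)
        = (LINT s|lborel. f s * indicator {y - d k<..y} s) - (LINT s|lborel. f s * indicator {x - d k<..x} s)"
      using d_pos[of k] by (simp add: a_def field_simps)
    also have "\<dots> = (LINT s|lborel. f s * indicator {y - d k<..y} s - f s * indicator {x - d k<..x} s)"
      using int K by simp
    \<comment> \<open>Written with half-lines, both differences of indicators coincide; the exchange
      trades windows of length \<open>d k\<close> for windows of length y - x.\<close>
    also have "\<dots> = (LINT s|lborel. f s * indicator {x<..y} s - f s * indicator {x - d k<..y - d k} s)"
      using that d_pos[of k] by (intro Bochner_Integration.integral_cong) (auto split: split_indicator)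
    also have "\<dots> = (LINT s|lborel. f s * indicator {x<..y} s) - (LINT s|lborel. f (s - d k) * indicator {x<..y} s)"
      unfolding shift[symmetric] using int K by simp
    also have "\<dots> = (LINT s|lborel. D k s * indicator {x<..y} s)"
      using int[of f] int[of "\<lambda>s. f (s - d k)"] K by (simp add: D_def left_diff_distrib)
    finally have "\<bar>d k * (a k y - a k x)\<bar> \<le> (LINT s|lborel. \<bar>D k s * indicator {x<..y} s\<bar>)"
      using integral_abs_bound by metis
    then have "d k * \<bar>a k y - a k x\<bar> \<le> (LINT s|lborel. \<bar>D k s\<bar> * indicator {x<..y} s)"
      using d_pos[of k] by (simp add: abs_mult)
    then show ?thesis unfolding W_diff[OF that] using d_pos[of k] by (simp add: field_simps)
  qed
  have "\<exists>s. strict_mono (s::nat \<Rightarrow> nat) \<and> (\<exists>F. (\<forall>x. continuous (at_right x) F) \<and> mono F \<and> (\<forall>x. \<bar>F x\<bar> \<le> C) \<and>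
    (\<forall>x. continuous (at x) F \<longrightarrow> (\<lambda>n. W (s n) x) \<longlonglongrightarrow> F x))"
  proof (rule Helly_selection)
    show "mono (W k)" for k by (auto simp: mono_def W_mono)
    show "\<bar>W k x\<bar> \<le> C" for k x by (rule W_bd)
    have "(2 * K / d k)-lipschitz_on UNIV (W k)" for k
    proof (rule lipschitz_onI)
      show "dist (W k x) (W k y) \<le> 2 * K / d k * dist x y" for x y
        using W_lip[of x y k] W_lip[of y x k] W_mono[of x y k] W_mono[of y x k]
        by (cases "x \<le> y") (auto simp: dist_real_def)
      show "0 \<le> 2 * K / d k" using K[of 0] d_pos[of k] by simp
    qed
    then show "continuous (at_right x) (W k)" for k x
      using lipschitz_on_continuous_on continuous_on_imp_continuous_within by blast
  qed
  then obtain s F where s: "strict_mono s" "mono F"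
    and lim: "\<And>x. isCont F x \<Longrightarrow> (\<lambda>n. W (s n) x) \<longlonglongrightarrow> F x" by blast
  define E where "E = {x. isCont F x \<and> (\<lambda>k. a k x) \<longlonglongrightarrow> f x}"
  show thesis
  proof
    have "countable {x. \<not> isCont F x}" by (rule mono_ctble_discont[OF s(2)])
    then have "AE x in lborel. x \<notin> {x. \<not> isCont F x}"
      by (intro AE_not_in) (simp add: null_sets_def emeasure_lborel_countable sets.countable)
    moreover have "AE x in lborel. (\<lambda>k. a k x) \<longlonglongrightarrow> f x"
      unfolding a_def by (rule bv_averages_converge[OF f K C d_def])
    ultimately show "AE x in lborel. x \<in> E" by eventually_elim (simp add: E_def)
    show "isCont F x" if "x \<in> E" for x using that by (simp add: E_def)
    fix x y assume xy: "x \<in> E" "y \<in> E" "x \<le> y"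
    have "(\<lambda>n. a (s n) x) \<longlonglongrightarrow> f x" "(\<lambda>n. a (s n) y) \<longlonglongrightarrow> f y"
      using xy LIMSEQ_subseq_LIMSEQ[OF _ s(1)] by (auto simp: E_def o_def)
    then have "(\<lambda>n. \<bar>a (s n) y - a (s n) x\<bar>) \<longlonglongrightarrow> \<bar>f y - f x\<bar>" by (intro tendsto_intros)
    moreover have "(\<lambda>n. W (s n) y - W (s n) x) \<longlonglongrightarrow> F y - F x"
      using xy by (intro tendsto_intros lim) (auto simp: E_def)
    ultimately show "\<bar>f y - f x\<bar> \<le> F y - F x"
      by (rule LIMSEQ_le) (use a_W[OF xy(3)] in auto)
  qed
qed

text \<open>On a conull set the increments of f are controlled by a function continuous at its
  points, so f is continuous relative to that set. What remains is a choice of values on the null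
  set left over.\<close>

lemma bv_right_lsc_representative:
  fixes f :: "real \<Rightarrow> real"
  assumes f: "f \<in> borel_measurable lebesgue" "f \<in> BV" and V: "AE x in lebesgue. 0 \<le> f x \<and> f x \<le> V"
    and S: "finite S"
  obtains v where "v \<in> borel_measurable borel" "\<And>x. 0 \<le> v x" "\<And>x. v x \<le> V"
    "AE x in lebesgue. f x = v x" "\<And>x. x \<in> S \<Longrightarrow> v x = 0"
    "AE y in lborel. \<forall>e>0. \<exists>d>0. \<forall>z\<in>{y..<y+d}. v y - e < v z"
proof -
  obtain g0 where g0: "g0 \<in> borel_measurable lborel" "AE x in lborel. f x = g0 x"
    using completion_ex_borel_measurable_real[OF f(1)] by auto
  have V_nonneg: "0 \<le> V"
  proof (rule ccontr)
    assume "\<not> 0 \<le> V"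
    then have "AE x in (lebesgue :: real measure). False" using V by auto
    then show False by (simp add: eventually_False ae_filter_eq_bot_iff)
  qed
  define g where "g x = max 0 (min V (g0 x))" for x
  have g_meas [measurable]: "g \<in> borel_measurable borel" using g0(1) unfolding g_def by simp
  have g_bd: "0 \<le> g x" "g x \<le> V" for x using V_nonneg by (auto simp: g_def)
  have fg: "AE x in lborel. f x = g x"
    using g0(2) V[unfolded AE_completion_iff] by eventually_elim (auto simp: g_def)
  then have fg': "AE x in lebesgue. f x = g x" by (simp add: AE_completion_iff)
  obtain C where C: "\<And>\<phi>. \<phi> C1_differentiable_on UNIV \<Longrightarrow> compact (closure {x. \<phi> x \<noteq> 0}) \<Longrightarrow>
      (\<And>x. \<bar>\<phi> x\<bar> \<le> 1) \<Longrightarrow> (LINT x|lebesgue. f x * deriv \<phi> x) \<le> C"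
    using f(2) unfolding BV_def by auto
  have test: "(LINT x|lborel. g x * deriv \<phi> x) \<le> max 0 C"
    if "\<phi> C1_differentiable_on UNIV" "compact (closure {x. \<phi> x \<noteq> 0})" "\<And>x. \<bar>\<phi> x\<bar> \<le> 1" for \<phi> :: "real \<Rightarrow> real"
  proof -
    obtain D where D: "\<And>x. (\<phi> has_vector_derivative D x) (at x)" "continuous_on UNIV D"
      using \<open>\<phi> C1_differentiable_on UNIV\<close> unfolding C1_differentiable_on_def by blast
    have "deriv \<phi> = D"
      using D(1) by (auto intro!: DERIV_imp_deriv simp: has_real_derivative_iff_has_vector_derivative)
    then have [measurable]: "deriv \<phi> \<in> borel_measurable borel"
      using borel_measurable_continuous_onI[OF D(2)] by simp
    have "(LINT x|lborel. g x * deriv \<phi> x) = (LINT x|lebesgue. g x * deriv \<phi> x)"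
      by (rule integral_completion[symmetric]) simp
    also have "\<dots> = (LINT x|lebesgue. f x * deriv \<phi> x)"
    proof (rule integral_cong_AE)
      have "deriv \<phi> \<in> borel_measurable lebesgue" "g \<in> borel_measurable lebesgue"
        by (auto intro: measurable_completion)
      then show "(\<lambda>x. g x * deriv \<phi> x) \<in> borel_measurable lebesgue"
        "(\<lambda>x. f x * deriv \<phi> x) \<in> borel_measurable lebesgue"
        using f(1) by (auto intro: borel_measurable_times)
      show "AE x in lebesgue. g x * deriv \<phi> x = f x * deriv \<phi> x" using fg' by eventually_elim simp
    qed
    also have "\<dots> \<le> C" by (rule C[OF that])
    finally show ?thesis by simp
  qed
  have trans: "(\<integral>\<^sup>+ x. ennreal \<bar>g x - g (x - e)\<bar> \<partial>lborel) \<le> ennreal (max 0 C * e)" if "0 < e" for e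
    by (rule bv_translation[OF g_meas _ test that, of V]) (use g_bd in \<open>auto simp: abs_le_iff\<close>)
  obtain E F where EF: "AE x in lborel. x \<in> E" "\<And>x. x \<in> E \<Longrightarrow> isCont F x"
    "\<And>x y. x \<in> E \<Longrightarrow> y \<in> E \<Longrightarrow> x \<le> y \<Longrightarrow> \<bar>g y - g x\<bar> \<le> F y - F x"
    by (rule bv_continuous_on_conull_set[OF g_meas _ _ trans, of V]) (use g_bd in \<open>auto simp: abs_le_iff\<close>)
  obtain N where N: "{x. x \<notin> E} \<subseteq> N" "N \<in> null_sets lborel"
    using EF(1) unfolding eventually_ae_filter by auto
  have N_sets [measurable]: "N \<in> sets borel" using N(2) by auto
  have S_sets [measurable]: "S \<in> sets borel" by (rule borel_closed[OF finite_imp_closed[OF S]])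
  have "S \<union> N \<in> null_sets lborel"
    using N(2) finite_imp_null_set_lborel[OF S] by auto
  then have good: "AE x in lborel. x \<notin> S \<union> N" by (rule AE_not_in)
  \<comment> \<open>The maximal value V on the exceptional null set cannot spoil lower
    semicontinuity at other points. The prescribed zeros could, but they lie in the finite set S,
    from which every other point has positive distance.\<close>
  define v where "v x = (if x \<in> S then 0 else if x \<in> N then V else g x)" for x
  show thesis
  proof
    show "v \<in> borel_measurable borel" unfolding v_def by measurable
    show "0 \<le> v x" "v x \<le> V" for x using g_bd V_nonneg by (auto simp: v_def)
    show "v x = 0" if "x \<in> S" for x using that by (simp add: v_def)
    have "AE x in lborel. f x = v x" using fg good by eventually_elim (simp add: v_def)
    then show "AE x in lebesgue. f x = v x" by (simp add: AE_completion_iff)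
    show "AE y in lborel. \<forall>e>0. \<exists>d>0. \<forall>z\<in>{y..<y+d}. v y - e < v z"
      using good
    proof eventually_elim
      case (elim y)
      have y: "y \<in> E" "v y = g y" using elim N(1) by (auto simp: v_def)
      show ?case
      proof (intro allI impI)
        fix e :: real assume "0 < e"
        then obtain d1 where d1: "0 < d1" "\<And>z. dist z y < d1 \<Longrightarrow> dist (F z) (F y) < e"
          using EF(2)[OF y(1)] unfolding continuous_at_eps_delta by blast
        obtain d2 where d2: "0 < d2" "\<And>z. z \<in> S \<Longrightarrow> z \<noteq> y \<Longrightarrow> d2 \<le> dist y z"
          using finite_set_avoid[OF S, of y] by blast
        have "v y - e < v z" if z: "z \<in> {y..<y + min d1 d2}" for z
        proof -
          have "z \<notin> S" using d2(2)[of z] z elim by (cases "z = y") (auto simp: dist_real_def)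
          show ?thesis
          proof (cases "z \<in> N")
            case True
            then show ?thesis using \<open>z \<notin> S\<close> g_bd(2)[of y] y \<open>0 < e\<close> by (simp add: v_def)
          next
            case False
            then have "z \<in> E" "v z = g z" using \<open>z \<notin> S\<close> N(1) by (auto simp: v_def)
            moreover have "\<bar>F z - F y\<bar> < e" using d1(2)[of z] z by (auto simp: dist_real_def)
            ultimately show ?thesis using EF(3)[OF y(1), of z] z y by auto
          qed
        qed
        then show "\<exists>d>0. \<forall>z\<in>{y..<y+d}. v y - e < v z"
          using d1(1) d2(1) by (intro exI[of _ "min d1 d2"]) auto
      qed
    qed
  qed
qed

text \<open>The two bounds add up once the integral of the sum splits. Each product is integrable
  because the derivative of a test function is bounded with compact support, while f and g are
  locally integrable.\<close>

lemma BV_add: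
  assumes "f \<in> BV" "g \<in> BV"
  shows "(\<lambda>x. f x + g x) \<in> BV"
proof -
  obtain C D where
    f: "\<And>a b. set_integrable lebesgue {a..b} f" "\<And>\<phi>. \<phi> C1_differentiable_on UNIV \<Longrightarrow> compact (closure {x. \<phi> x \<noteq> 0}) \<Longrightarrow>
      (\<forall>x. \<bar>\<phi> x\<bar> \<le> 1) \<Longrightarrow> (LINT x|lebesgue. f x * deriv \<phi> x) \<le> C"
    and g: "\<And>a b. set_integrable lebesgue {a..b} g" "\<And>\<phi>. \<phi> C1_differentiable_on UNIV \<Longrightarrow> compact (closure {x. \<phi> x \<noteq> 0}) \<Longrightarrow>
      (\<forall>x. \<bar>\<phi> x\<bar> \<le> 1) \<Longrightarrow> (LINT x|lebesgue. g x * deriv \<phi> x) \<le> D"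
    using assms unfolding BV_def by blast
  have "(LINT x|lebesgue. (f x + g x) * deriv \<phi> x) \<le> C + D"
    if \<phi>: "\<phi> C1_differentiable_on UNIV" "compact (closure {x. \<phi> x \<noteq> 0})" "\<forall>x. \<bar>\<phi> x\<bar> \<le> 1" for \<phi> :: "real \<Rightarrow> real"
  proof -
    have int: "integrable lebesgue (\<lambda>x. k x * deriv \<phi> x)" if k: "\<And>a b. set_integrable lebesgue {a..b} k" for k
    proof -
      obtain D where D: "\<And>x. (\<phi> has_vector_derivative D x) (at x)" "continuous_on UNIV D"
        using \<phi>(1) unfolding C1_differentiable_on_def by blast
      have D_eq: "deriv \<phi> = D"
        using D(1) by (auto intro!: DERIV_imp_deriv simp: has_real_derivative_iff_has_vector_derivative)
      obtain R where R: "\<And>x. x \<in> closure {x. \<phi> x \<noteq> 0} \<Longrightarrow> \<bar>x\<bar> \<le> R"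
        using compact_imp_bounded[OF \<phi>(2)] unfolding bounded_iff by auto
      have D0: "D x = 0" if "x \<notin> {-R..R}" for x
      proof -
        have x: "x \<in> - closure {x. \<phi> x \<noteq> 0}" using R[of x] that by (auto simp: abs_le_iff)
        have op: "open (- closure {x. \<phi> x \<noteq> 0})" by (simp add: open_Compl)
        have "0 = \<phi> y" if "y \<in> - closure {x. \<phi> x \<noteq> 0}" for y
          using that closure_subset[of "{x. \<phi> x \<noteq> 0}"] by auto
        from has_vector_derivative_transform_within_open[OF has_vector_derivative_const op x this]
        have "(\<phi> has_vector_derivative 0) (at x)" by simp
        then show ?thesis using vector_derivative_unique_at[OF D(1)] by simp
      qed
      have "bounded (D ` {-R..R})"
        by (intro compact_imp_bounded compact_continuous_image continuous_on_subset[OF D(2)]) auto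
      then obtain B where B: "\<forall>x\<in>{-R..R}. \<bar>D x\<bar> \<le> B" unfolding bounded_iff by auto
      have D_bd: "\<bar>D x\<bar> \<le> max 0 B" for x using bspec[OF B, of x] D0[of x] by (cases "x \<in> {-R..R}") auto
      have "D \<in> borel_measurable lebesgue"
        by (rule measurable_completion) (simp add: borel_measurable_continuous_onI[OF D(2)])
      define kk where "kk x = indicator {-R..R} x *\<^sub>R k x" for x
      have kk: "integrable lebesgue kk" using k[of "-R" R] by (simp add: set_integrable_def kk_def[abs_def])
      have "integrable lebesgue (\<lambda>x. D x * kk x)"
      proof (rule Bochner_Integration.integrable_bound)
        show "integrable lebesgue (\<lambda>x. max 0 B * norm (kk x))"
          by (intro integrable_mult_right integrable_norm kk)
        show "(\<lambda>x. D x * kk x) \<in> borel_measurable lebesgue"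
          by (rule borel_measurable_times[OF \<open>D \<in> borel_measurable lebesgue\<close> borel_measurable_integrable[OF kk]])
        have "norm (D x * kk x) \<le> norm (max 0 B * norm (kk x))" for x
          using mult_right_mono[OF D_bd[of x] abs_ge_zero[of "kk x"]] by (simp add: abs_mult)
        then show "AE x in lebesgue. norm (D x * kk x) \<le> norm (max 0 B * norm (kk x))" by simp
      qed
      also have "(\<lambda>x. D x * kk x) = (\<lambda>x. k x * deriv \<phi> x)"
        using D0 by (auto simp: D_eq kk_def fun_eq_iff split: split_indicator)
      finally show ?thesis .
    qed
    have "(LINT x|lebesgue. (f x + g x) * deriv \<phi> x) = (LINT x|lebesgue. f x * deriv \<phi> x) + (LINT x|lebesgue. g x * deriv \<phi> x)"
      using int[OF f(1)] int[OF g(1)] by (simp add: distrib_right)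
    then show ?thesis using f(2)[OF \<phi>] g(2)[OF \<phi>] by simp
  qed
  then show ?thesis
    unfolding BV_def using set_integral_add(1)[OF f(1) g(1)] by blast
qed

subsection \<open>The road\<close>

lemma nstar_measurable: "nstar M r c \<in> borel_measurable borel"
  unfolding nstar_def by measurable

lemma nstar_nonneg: "(\<And>j. j \<le> M \<Longrightarrow> c j \<in> {1, 2}) \<Longrightarrow> 0 \<le> nstar M r c x"
  unfolding nstar_def by (intro sum_nonneg mult_nonneg_nonneg) fastforce+

lemma nstar_upper: 
  assumes "\<And>j. j \<le> M \<Longrightarrow> c j \<in> {1, 2}"
  shows "nstar M r c x \<le> 2 * (real M + 1)"
proof -
  have "nstar M r c x \<le> (\<Sum>j=0..M. 2)"
    unfolding nstar_def
  proof (rule sum_mono)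
    fix j assume "j \<in> {0..M}"
    then have "c j = 1 \<or> c j = 2" using assms[of j] by auto
    then show "c j * indicator {breakpoint M r j<..<breakpoint M r (Suc j)} (ereal x) \<le> 2"
      by (auto split: split_indicator)
  qed
  then show ?thesis by simp
qed

text \<open>Away from its zeros, dividing by \<open>nstar\<close> does not increase a nonnegative
  function; this makes the relative density integrable.\<close>

lemma nstar_zero_or_ge_1:
  assumes "\<And>j. j \<le> M \<Longrightarrow> c j \<in> {1, 2}"
  shows "nstar M r c x = 0 \<or> 1 \<le> nstar M r c x"
proof (cases "\<exists>j\<le>M. ereal x \<in> {breakpoint M r j<..<breakpoint M r (Suc j)}")
  case True
  then obtain j where j: "j \<le> M" "ereal x \<in> {breakpoint M r j<..<breakpoint M r (Suc j)}" by auto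
  have pos: "0 \<le> c i * indicator {breakpoint M r i<..<breakpoint M r (Suc i)} (ereal x)" if "i \<le> M" for i
    using assms[OF that] by (auto split: split_indicator)
  have "1 \<le> c j * indicator {breakpoint M r j<..<breakpoint M r (Suc j)} (ereal x)"
    using assms[OF j(1)] j(2) by auto
  also have "\<dots> \<le> nstar M r c x"
    unfolding nstar_def using j(1) pos by (intro member_le_sum) auto
  finally show ?thesis by simp
next
  case False
  then have "nstar M r c x = 0" unfolding nstar_def by (intro sum.neutral) auto
  then show ?thesis ..
qed

text \<open>The sum sees x only through its position relative to the breakpoints, so
  \<open>nstar\<close> is constant along a trajectory that meets none.\<close>

lemma nstar_cong:
  assumes "\<And>j. j \<in> {1..M} \<Longrightarrow> (r j < x \<longleftrightarrow> r j < y) \<and> (x < r j \<longleftrightarrow> y < r j)"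
  shows "nstar M r c x = nstar M r c y"
  unfolding nstar_def
proof (rule sum.cong[OF refl])
  fix j assume j: "j \<in> {0..M}"
  have "breakpoint M r j < ereal x \<longleftrightarrow> breakpoint M r j < ereal y"
    using assms[of j] j by (auto simp: breakpoint_def)
  moreover have "ereal x < breakpoint M r (Suc j) \<longleftrightarrow> ereal y < breakpoint M r (Suc j)"
    using assms[of "Suc j"] j by (auto simp: breakpoint_def)
  ultimately show "c j * indicator {breakpoint M r j<..<breakpoint M r (Suc j)} (ereal x)
      = c j * indicator {breakpoint M r j<..<breakpoint M r (Suc j)} (ereal y)"
    by (simp add: indicator_def)
qed

lemma I_fun_measurable: "I_fun \<alpha> M r c \<in> borel_measurable borel"
  unfolding I_fun_def using nstar_measurable[of M r c] by measurable

lemma I_fun_bounds: "1 \<le> \<alpha> \<Longrightarrow> \<bar>I_fun \<alpha> M r c x\<bar> \<le> 1"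
  by (auto simp: I_fun_def)

lemma Linfty_LinftyI:
  assumes "f \<in> borel_measurable borel" "\<And>t x. 0 < t \<Longrightarrow> \<bar>f (t, x)\<bar> \<le> C"
  shows "f \<in> Linfty_Linfty"
  unfolding Linfty_Linfty_def
proof (intro CollectI conjI exI[of _ C])
  show "f \<in> borel_measurable (lebesgue_on open_half_plane)"
    using assms(1) by (intro measurable_restrict_space1 measurable_completion) simp
  have "(\<lambda>x. f (t, x)) \<in> borel_measurable lebesgue" for t
    using assms(1) by (intro measurable_completion) simp
  then show "AE t in lebesgue_on {0<..}. (\<lambda>x. f (t, x)) \<in> borel_measurable lebesgue \<and> (AE x in lebesgue. \<bar>f (t, x)\<bar> \<le> C)"
    using assms(2) by (intro AE_I2) simp
qed

theorem theorem4p2: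
  fixes M :: nat and r c :: "nat \<Rightarrow> real" and \<alpha> :: real
    and n0 u0 p0 :: "real \<Rightarrow> real"
  assumes "strict_mono_on {1..M} r"
    and "\<And>j. j \<le> M \<Longrightarrow> c j \<in> {1, 2}"
    and "\<alpha> \<ge> 1"
    and "n0 \<in> L1 lebesgue"
    and "u0 \<in> Linfty lebesgue \<inter> BV"
    and "p0 \<in> Linfty lebesgue \<inter> BV"
    and "AE x in lebesgue. 0 \<le> u0 x \<and> 0 \<le> p0 x \<and> 0 \<le> n0 x \<and> n0 x \<le> nstar M r c x \<and>
           (nstar M r c x - n0 x) * p0 x = 0"
  shows "\<exists>n u p :: real \<times> real \<Rightarrow> real.
           n \<in> Linfty_Linfty \<inter> Linfty_L1 \<and> u \<in> Linfty_Linfty \<and> p \<in> Linfty_Linfty \<and>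
           weak_solution (nstar M r c) (I_fun \<alpha> M r c) n0 u0 p0 n u p \<and>
           (AE (t, x) in lebesgue_on open_half_plane.
              0 \<le> u (t, x) \<and>
              ereal (u (t, x)) \<le>
                ereal (2 * \<alpha>) * (esssup lebesgue (\<lambda>y. ereal (u0 y)) + esssup lebesgue (\<lambda>y. ereal (p0 y))) \<and>
              0 \<le> p (t, x) \<and>
              ereal (p (t, x)) \<le>
                ereal (2 * \<alpha>) * (esssup lebesgue (\<lambda>y. ereal (u0 y)) + esssup lebesgue (\<lambda>y. ereal (p0 y))))"
proof -
  define ns where "ns = nstar M r c"
  define I where "I = I_fun \<alpha> M r c"
  have ns_meas [measurable]: "ns \<in> borel_measurable borel" unfolding ns_def by (rule nstar_measurable)
  have I_meas [measurable]: "I \<in> borel_measurable borel" unfolding I_def by (rule I_fun_measurable)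
  have ns: "0 \<le> ns x" "ns x \<le> 2 * (real M + 1)" "ns x = 0 \<or> 1 \<le> ns x" for x
    unfolding ns_def using assms(2) by (intro nstar_nonneg nstar_upper nstar_zero_or_ge_1; blast)+
  have I_bd: "\<bar>I x\<bar> \<le> 1" for x unfolding I_def by (rule I_fun_bounds[OF assms(3)])
  have n0_int: "integrable lebesgue n0" using assms(4) by (simp add: L1_def)
  have n0_meas [measurable]: "n0 \<in> borel_measurable lebesgue" using n0_int by auto
  have up_meas [measurable]: "u0 \<in> borel_measurable lebesgue" "p0 \<in> borel_measurable lebesgue"
    using assms(5,6) by (auto simp: Linfty_def)

  \<comment> \<open>The essential supremum is finite: the bound from \<open>Linfty\<close> excludes
    \<infinity>, and f \<ge> 0 on a space of nonzero measure excludes -\<infinity>.\<close>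
  have sup: "\<exists>a. esssup lebesgue (\<lambda>y. ereal (f y)) = ereal a \<and> (AE x in lebesgue. f x \<le> a)"
    if f: "f \<in> Linfty lebesgue" "AE x in lebesgue. 0 \<le> f x" for f :: "real \<Rightarrow> real"
  proof -
    have [measurable]: "f \<in> borel_measurable lebesgue" using f(1) by (simp add: Linfty_def)
    obtain C where C: "AE x in lebesgue. \<bar>f x\<bar> \<le> C" using f(1) by (auto simp: Linfty_def)
    let ?s = "esssup lebesgue (\<lambda>y. ereal (f y))"
    have "?s \<le> ereal C" using C by (intro esssup_I) (auto elim!: eventually_mono)
    moreover have le: "AE x in lebesgue. ereal (f x) \<le> ?s" by (rule esssup_AE)
    have "AE x in (lebesgue :: real measure). 0 \<le> ?s"
      using le f(2) by eventually_elim (metis ereal_less_eq(5) order_trans)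
    then have "0 \<le> ?s"
      by (rule contrapos_pp) (simp add: eventually_False ae_filter_eq_bot_iff)
    ultimately obtain a where "?s = ereal a" by (cases ?s) auto
    then show ?thesis using le by auto
  qed
  have "AE x in lebesgue. 0 \<le> u0 x" "AE x in lebesgue. 0 \<le> p0 x"
    using assms(7) by (auto elim!: eventually_mono)
  then obtain a b where ab: "esssup lebesgue (\<lambda>y. ereal (u0 y)) = ereal a" "AE x in lebesgue. u0 x \<le> a"
    "esssup lebesgue (\<lambda>y. ereal (p0 y)) = ereal b" "AE x in lebesgue. p0 x \<le> b"
    using sup[of u0] sup[of p0] assms(5,6) by auto
  define V where "V = a + b"

  have bds: "AE x in lebesgue. 0 \<le> u0 x + p0 x \<and> u0 x + p0 x \<le> V"
    using assms(7) ab(2,4) by eventually_elim (auto simp: V_def)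
  have m: "(\<lambda>x. u0 x + p0 x) \<in> borel_measurable lebesgue" by measurable
  have bv: "(\<lambda>x. u0 x + p0 x) \<in> BV" using assms(5,6) by (intro BV_add) auto
  have fin: "finite (r ` {1..M})" by simp
  \<comment> \<open>The red lights: v vanishes at the breakpoints, and being equal to u0 + p0 almost
    everywhere it still represents the data.\<close>
  obtain v where v: "v \<in> borel_measurable borel" "\<And>x. 0 \<le> v x" "\<And>x. v x \<le> V"
    "AE x in lebesgue. u0 x + p0 x = v x" "\<And>x. x \<in> r ` {1..M} \<Longrightarrow> v x = 0"
    "AE y in lborel. \<forall>e>0. \<exists>d>0. \<forall>z\<in>{y..<y+d}. v y - e < v z"
    by (rule bv_right_lsc_representative[OF m bv bds fin]) blast
  note v_meas [measurable] = v(1)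

  have "(\<lambda>x. n0 x / ns x) \<in> borel_measurable lebesgue"
    using measurable_completion[of ns lborel borel] by (intro borel_measurable_divide n0_meas) simp
  then obtain g where g: "g \<in> borel_measurable lborel" "AE x in lborel. n0 x / ns x = g x"
    using completion_ex_borel_measurable_real by blast
  \<comment> \<open>Truncation makes the bounds hold at every point. Where \<open>ns x = 0\<close>
    the quotient is 0 by convention, and there the constraint on n0 forces n0 to vanish as well, so
    the factorisation of n0 survives.\<close>
  define h0 where "h0 x = max 0 (min 1 (g x))" for x
  have h0_meas [measurable]: "h0 \<in> borel_measurable borel" using g(1) unfolding h0_def by simp
  have n0_eq: "AE x in lebesgue. n0 x = h0 x * ns x"
    using assms(7) g(2)[THEN AE_completion]
  proof eventually_elim
    case (elim x)
    have "0 \<le> n0 x" "n0 x \<le> ns x" using elim by (auto simp: ns_def)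
    then have "0 \<le> n0 x / ns x" "n0 x / ns x \<le> 1" using ns(1)[of x] by (auto simp: divide_le_eq)
    then have "h0 x = n0 x / ns x" using elim by (simp add: h0_def)
    then show ?case using \<open>0 \<le> n0 x\<close> \<open>n0 x \<le> ns x\<close> by auto
  qed
  have h0_int: "integrable lborel h0"
  proof -
    have "integrable lebesgue h0"
    proof (rule Bochner_Integration.integrable_bound[OF n0_int])
      show "h0 \<in> borel_measurable lebesgue" by (rule measurable_completion) simp
      show "AE x in lebesgue. norm (h0 x) \<le> norm (n0 x)"
        using n0_eq assms(7) g(2)[THEN AE_completion]
      proof eventually_elim
        case (elim x)
        show ?case
        proof (cases "ns x = 0")
          case True
          then show ?thesis using elim by (simp add: h0_def)
        next
          case False
          then have "h0 x * 1 \<le> h0 x * ns x" using ns(3)[of x] by (intro mult_left_mono) (auto simp: h0_def)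
          then show ?thesis using elim(1) ns(1)[of x] by (simp add: abs_mult) (simp add: h0_def)
        qed
      qed
    qed
    then show ?thesis by (simp add: integrable_completion)
  qed

  interpret follow_the_leader h0 v V
  proof unfold_locales
    show "0 \<le> h0 y" "h0 y \<le> 1" for y by (auto simp: h0_def)
  qed (use h0_int v in auto)

  have lsc: "AE y in lborel. 0 < h0 y \<longrightarrow> right_lsc y"
    using v(6) by eventually_elim (simp add: right_lsc_def)
  \<comment> \<open>A label that is not dead has mass between itself and any red light ahead, so
    \<open>X_barrier\<close> keeps it strictly before the light. As cars never move backwards, it
    also stays beyond the lights behind it.\<close>
  have ns_flow: "AE w in lborel. 0 < fst w \<and> 0 < h0 (snd w) \<longrightarrow> ns (snd (flow w)) = ns (snd w)
      \<and> I (snd (flow w)) = I (snd w)"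
  proof -
    have "finite (r ` {1..M})" by simp
    then have "AE y in lborel. y \<notin> r ` {1..M}"
      by (intro AE_not_in finite_imp_null_set_lborel)
    from AE_snd_lborel[OF this] AE_snd_lborel[OF AE_dead] show ?thesis
    proof eventually_elim
      case (elim w)
      obtain t y where w: "w = (t, y)" by fastforce
      show ?case
      proof
        assume "0 < fst w \<and> 0 < h0 (snd w)"
        then have t: "0 < t" and alive: "\<not> dead y" using elim by (auto simp: w)
        have "(r j < X t y \<longleftrightarrow> r j < y) \<and> (X t y < r j \<longleftrightarrow> y < r j)" if "j \<in> {1..M}" for j
        proof -
          have "r j \<noteq> y" using elim(1) that by (auto simp: w)
          moreover have "X t y < r j" if "y < r j"
          proof -
            have "X t y \<le> r j - (G (r j) - G y)"
              using v(5)[of "r j"] \<open>j \<in> {1..M}\<close> that by (intro X_barrier) auto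
            moreover have "G (r j) \<noteq> G y" using alive that by (auto simp: dead_def)
            ultimately show ?thesis using G_mono[of y "r j"] that by simp
          qed
          ultimately show ?thesis using X_ge[of t y] t by fastforce
        qed
        then have "nstar M r c (X t y) = nstar M r c y" by (intro nstar_cong) blast
        then show "ns (snd (flow w)) = ns (snd w) \<and> I (snd (flow w)) = I (snd w)"
          by (simp add: w flow_def ns_def I_def I_fun_def)
      qed
    qed
  qed

  define n where "n z = ns (snd z) * h z" for z :: "real \<times> real"
  have n_meas [measurable]: "n \<in> borel_measurable borel" unfolding n_def by measurable
  have n_bd: "0 \<le> n z" "n z \<le> ns (snd z)" for z
    using ns(1)[of "snd z"] h_nonneg[of z] h_le_1[of z] by (auto simp: n_def mult_left_le)
  have V_nonneg: "0 \<le> V" using v(2,3)[of 0] by linarith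

  have "weak_conservation_law (\<lambda>z. h z * ns (snd z)) (\<lambda>z. h z * ns (snd z) * u z) n0"
  proof (rule weak_law[where q=ns and B="2 * (real M + 1)"])
    show "AE w in lborel. 0 < fst w \<and> 0 < h0 (snd w) \<longrightarrow> ns (snd (flow w)) = ns (snd w) \<and> u (flow w) = uL (fst w) (snd w)"
      using ns_flow u_flow[OF lsc] by eventually_elim simp
  qed (use ns u_bounds n0_eq in \<open>auto simp: abs_le_iff intro: order_trans[of "- _" 0]\<close>)
  then have law1: "weak_conservation_law n (\<lambda>z. n z * u z) n0"
    by (simp add: n_def[abs_def] mult.commute)

  \<comment> \<open>The product h Q is n (u + p) I, because u + p is the desired velocity of the
    label found at z. Each of the factors \<open>ns\<close>, v and I is carried unchanged along a
    trajectory.\<close>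
  define Q where "Q z = ns (snd z) * v (A (fst z) (snd z)) * I (snd z)" for z
  define q where "q y = ns y * v y * I y" for y
  have bd: "\<bar>ns x * v y * I x\<bar> \<le> 2 * (real M + 1) * V" for x y
  proof -
    have "\<bar>ns x\<bar> * \<bar>v y\<bar> * \<bar>I x\<bar> \<le> 2 * (real M + 1) * V * 1"
      using ns[of x] v(2,3)[of y] I_bd[of x] V_nonneg by (intro mult_mono) auto
    then show ?thesis by (simp add: abs_mult)
  qed
  have "weak_conservation_law (\<lambda>z. h z * Q z) (\<lambda>z. h z * Q z * u z) (\<lambda>x. n0 x * (u0 x + p0 x) * I x)"
  proof (rule weak_law[where q=q and B="2 * (real M + 1) * V"])
    show "Q \<in> borel_measurable borel" unfolding Q_def by measurable
    show "q \<in> borel_measurable borel" unfolding q_def by measurable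
    show "\<bar>Q z\<bar> \<le> 2 * (real M + 1) * V" "\<bar>q y\<bar> \<le> 2 * (real M + 1) * V" for z y
      unfolding Q_def q_def by (rule bd)+
    show "AE w in lborel. 0 < fst w \<and> 0 < h0 (snd w) \<longrightarrow> Q (flow w) = q (snd w) \<and> u (flow w) = uL (fst w) (snd w)"
      using ns_flow u_flow[OF lsc] A_flow by eventually_elim (simp add: Q_def q_def)
    have "I \<in> borel_measurable lebesgue" by (rule measurable_completion) simp
    then show "(\<lambda>x. n0 x * (u0 x + p0 x) * I x) \<in> borel_measurable lebesgue"
      by (intro borel_measurable_times borel_measurable_add n0_meas up_meas)
    show "AE x in lebesgue. n0 x * (u0 x + p0 x) * I x = h0 x * q x"
      using n0_eq v(4) by eventually_elim (simp add: q_def)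
  qed (use u_bounds in \<open>auto simp: abs_le_iff intro: order_trans[of "- _" 0]\<close>)
  moreover have "(\<lambda>(t, x). n (t, x) * (u (t, x) + p (t, x)) * I x) = (\<lambda>z. h z * Q z)"
    by (auto simp: fun_eq_iff u_plus_p n_def Q_def)
  moreover have "(\<lambda>(t, x). n (t, x) * u (t, x) * (u (t, x) + p (t, x)) * I x) = (\<lambda>z. h z * Q z * u z)"
    by (auto simp: fun_eq_iff u_plus_p n_def Q_def)
  ultimately have law2: "weak_conservation_law
       (\<lambda>(t, x). n (t, x) * (u (t, x) + p (t, x)) * I x)
       (\<lambda>(t, x). n (t, x) * u (t, x) * (u (t, x) + p (t, x)) * I x)
       (\<lambda>x. n0 x * (u0 x + p0 x) * I x)" by simp

  \<comment> \<open>Pressure is nonzero only where h = 1, and there n = ns. Positive time enters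
    through p \<ge> 0, which rests on the left derivative being at most v.\<close>
  have constraints: "0 \<le> n (t, x) \<and> n (t, x) \<le> ns x \<and> 0 \<le> u (t, x) \<and> 0 \<le> p (t, x) \<and> (ns x - n (t, x)) * p (t, x) = 0"
    if "0 < t" for t x
    using that n_bd[of "(t, x)"] u_bounds[of "(t, x)"] p_bounds[of "(t, x)"] by (auto simp: n_def p_def)
  have sol: "weak_solution ns I n0 u0 p0 n u p"
    unfolding weak_solution_def
  proof (intro conjI law1 law2)
    show "AE (t, x) in lebesgue_on open_half_plane.
        0 \<le> n (t, x) \<and> n (t, x) \<le> ns x \<and> 0 \<le> u (t, x) \<and> 0 \<le> p (t, x) \<and> (ns x - n (t, x)) * p (t, x) = 0"
      using constraints by (intro AE_I2) (auto simp: space_restrict_space open_half_plane_def)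
  qed

  \<comment> \<open>Both u and p are at most V = a + b; since V \<ge> 0 and 2 \<alpha> \<ge> 1, the
    stated bound follows.\<close>
  have V_le: "V \<le> 2 * \<alpha> * V"
    using mult_right_mono[of 1 "2 * \<alpha>" V] assms(3) V_nonneg by simp
  have bounds: "AE (t, x) in lebesgue_on open_half_plane.
              0 \<le> u (t, x) \<and> ereal (u (t, x)) \<le> ereal (2 * \<alpha>) * (ereal a + ereal b) \<and>
              0 \<le> p (t, x) \<and> ereal (p (t, x)) \<le> ereal (2 * \<alpha>) * (ereal a + ereal b)"
  proof (intro AE_I2)
    fix z :: "real \<times> real" assume "z \<in> space (lebesgue_on open_half_plane)"
    then have "0 < fst z" by (auto simp: space_restrict_space open_half_plane_def)
    then have "0 \<le> u z" "u z \<le> 2 * \<alpha> * V" "0 \<le> p z" "p z \<le> 2 * \<alpha> * V"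
      using u_bounds[of z] p_bounds[of z] V_le by auto
    then show "case z of (t, x) \<Rightarrow> 0 \<le> u (t, x) \<and> ereal (u (t, x)) \<le> ereal (2 * \<alpha>) * (ereal a + ereal b) \<and>
              0 \<le> p (t, x) \<and> ereal (p (t, x)) \<le> ereal (2 * \<alpha>) * (ereal a + ereal b)"
      by (auto simp: V_def split: prod.split)
  qed

  \<comment> \<open>For almost every t the section of h has at most the total mass of \<rho>;
    multiplying by the bound for \<open>ns\<close> gives a bound uniform in t.\<close>
  have "n \<in> Linfty_L1"
    unfolding Linfty_L1_def
  proof (intro CollectI conjI exI[of _ "2 * (real M + 1) * measure \<rho> UNIV"])
    show "n \<in> borel_measurable (lebesgue_on open_half_plane)"
      by (intro measurable_restrict_space1 measurable_completion) simp
    have "AE t in lebesgue. integrable lborel (\<lambda>x. h (t, x)) \<and> (LINT x|lborel. h (t, x)) \<le> measure \<rho> UNIV"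
      using h_section_integrable by (rule AE_completion)
    then have "AE t in lebesgue. (\<lambda>x. n (t, x)) \<in> L1 lebesgue \<and>
        (LINT x|lebesgue. \<bar>n (t, x)\<bar>) \<le> 2 * (real M + 1) * measure \<rho> UNIV"
    proof eventually_elim
      case (elim t)
      have le: "\<bar>n (t, x)\<bar> \<le> 2 * (real M + 1) * h (t, x)" for x
        using ns(1,2)[of x] h_nonneg[of "(t, x)"] by (auto simp: n_def abs_mult intro!: mult_right_mono)
      have int: "integrable lborel (\<lambda>x. n (t, x))"
      proof (rule Bochner_Integration.integrable_bound)
        show "integrable lborel (\<lambda>x. 2 * (real M + 1) * h (t, x))"
          using elim by (intro integrable_mult_right) simp
        show "(\<lambda>x. n (t, x)) \<in> borel_measurable lborel" by measurable
        have "norm (n (t, x)) \<le> norm (2 * (real M + 1) * h (t, x))" for x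
          using order_trans[OF le abs_ge_self] by simp
        then show "AE x in lborel. norm (n (t, x)) \<le> norm (2 * (real M + 1) * h (t, x))" by simp
      qed
      have "(LINT x|lborel. \<bar>n (t, x)\<bar>) \<le> (LINT x|lborel. 2 * (real M + 1) * h (t, x))"
        using int elim le by (intro integral_mono) auto
      also have "\<dots> \<le> 2 * (real M + 1) * measure \<rho> UNIV" using elim by (simp add: mult_left_mono)
      finally have "(LINT x|lborel. \<bar>n (t, x)\<bar>) \<le> 2 * (real M + 1) * measure \<rho> UNIV" .
      then show ?case
        using int by (simp add: L1_def integrable_completion integral_completion)
    qed
    then show "AE t in lebesgue_on {0<..}. (\<lambda>x. n (t, x)) \<in> L1 lebesgue \<and>
        (LINT x|lebesgue. \<bar>n (t, x)\<bar>) \<le> 2 * (real M + 1) * measure \<rho> UNIV"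
      by (subst AE_restrict_space_iff) auto
  qed
  moreover have "n \<in> Linfty_Linfty"
  proof (rule Linfty_LinftyI[OF n_meas])
    show "\<bar>n (t, x)\<bar> \<le> 2 * (real M + 1)" for t x
      using n_bd[of "(t, x)"] ns(2)[of x] by simp
  qed
  moreover have "u \<in> Linfty_Linfty" "p \<in> Linfty_Linfty"
    using u_bounds p_bounds by (auto intro!: Linfty_LinftyI[where C=V] simp: abs_le_iff intro: order_trans)
  ultimately show ?thesis
    using sol bounds unfolding ab ns_def I_def by blast
qed

end
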